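(* Let $V$ be a real vector space of countably infinite dimension and let $f:V\to\mathbb{R}$ be a positive definite quadratic form. Then there exists an algebraic automorphism $\varphi$ of $\mathcal{C}\ell(V,f)$ (that is, an automorphism of $\mathcal{C}\ell(V,f)$ as an $\mathbb{R}$-algebra) that is not continuous with respect to the norm $\|a\|=\mathrm{tr}(a\cdot a^{*})^{1/2}$ on $\mathcal{C}\ell(V,f)$.
   Context: A quadratic form on $V$ is a map $f:V\to\mathbb{R}$ with $f(\lambda v)=\lambda^2 f(v)$ such that $f(v,w)=f(v+w)-f(v)-f(w)$ is bilinear; it is positive definite if $f(v)>0$ for all $v\neq 0$. The Clifford algebra $\mathcal{C}\ell(V,f)$ is the unital associative $\mathbb{R}$-algebra generated by $V$ with defining relations $v^2=f(v)\cdot 1$, $v\in V$. The map $*$ is the involution (linear anti-automorphism) of $\mathcal{C}\ell(V,f)$ that fixes every element of $V$, i.e. $\left(\sum\alpha\,w_1\cdots w_n\right)^{*}=\sum\alpha\,w_n\cdots w_1$ for $\alpha\in\mathbb{R}$, $w_i\in V$. The functional $\mathrm{tr}:\mathcal{C}\ell(V,f)\to\mathbb{R}$ is the unique linear functional satisfying $\mathrm{tr}(ab)=\mathrm{tr}(ba)$ for all $a,b$ and $\mathrm{tr}(1)=1$. *)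

theory Defs
  imports
    "HOL-Analysis.Linear_Algebra"
    "HOL-Library.Countable_Set"
    "HOL-Library.Poly_Mapping"
    "HOL-Algebra.QuotRing"
    "HOL-Algebra.Module"
begin

section \<open>Quadratic forms\<close>

definition polar :: "('v::real_vector \<Rightarrow> real) \<Rightarrow> 'v \<Rightarrow> 'v \<Rightarrow> real" where
  "polar f v w = f (v + w) - f v - f w"

definition quadratic_form :: "('v::real_vector \<Rightarrow> real) \<Rightarrow> bool" where
  "quadratic_form f \<longleftrightarrow> (\<forall>c v. f (c *\<^sub>R v) = c\<^sup>2 * f v) \<and> bilinear (polar f)"

definition pos_definite :: "('v::real_vector \<Rightarrow> real) \<Rightarrow> bool" where
  "pos_definite f \<longleftrightarrow> (\<forall>v. v \<noteq> 0 \<longrightarrow> f v > 0)"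


section \<open>The free unital real algebra on a set of letters\<close>

text \<open>
  Words under concatenation, written additively: the convolution product of
  \<open>\<Rightarrow>\<^sub>0\<close> is then the product of the free algebra.
\<close>

datatype 'v word = Word (letters: "'v list")

instantiation word :: (type) monoid_add
begin

definition zero_word :: "'a word" where
  "zero_word = Word []"

definition plus_word :: "'a word \<Rightarrow> 'a word \<Rightarrow> 'a word" where
  "plus_word x y = Word (letters x @ letters y)"

instance
  by standard (simp_all add: zero_word_def plus_word_def)

end

definition rev_word :: "'v word \<Rightarrow> 'v word" where
  "rev_word w = Word (rev (letters w))"

type_synonym 'v free_alg = "'v word \<Rightarrow>\<^sub>0 real"

definition free_gen :: "'v \<Rightarrow> 'v free_alg" where
  "free_gen v = Poly_Mapping.single (Word [v]) 1"

definition free_const :: "real \<Rightarrow> 'v free_alg" where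
  "free_const c = Poly_Mapping.single 0 c"

definition free_ring :: "'v free_alg ring" where
  "free_ring = \<lparr>carrier = UNIV, monoid.mult = (*), one = 1, ring.zero = 0, add = (+)\<rparr>"

text \<open>
  Since \<^const>\<open>rev_word\<close> is its own inverse, the coefficient of \<open>w\<close> in \<open>free_star a\<close> is the
  coefficient of \<open>rev_word w\<close> in \<open>a\<close>.
\<close>

definition free_star :: "'v free_alg \<Rightarrow> 'v free_alg" where
  "free_star a = Poly_Mapping.map_key rev_word a"

lemma ring_free_ring: "ring free_ring"
proof (intro ringI abelian_groupI monoidI)
  fix x :: "'a free_alg"
  show "\<exists>y\<in>carrier free_ring. y \<oplus>\<^bsub>free_ring\<^esub> x = \<zero>\<^bsub>free_ring\<^esub>"
    by (rule bexI[of _ "- x"]) (simp_all add: free_ring_def)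
qed (simp_all add: free_ring_def algebra_simps)

lemma rev_word_rev_word [simp]: "rev_word (rev_word w) = w"
  by (simp add: rev_word_def)

lemma inj_rev_word: "inj rev_word"
  by (metis injI rev_word_rev_word)

lemma free_star_single [simp]:
  "free_star (Poly_Mapping.single w c) = Poly_Mapping.single (rev_word w) c"
  using map_key_single[OF inj_rev_word, of "rev_word w" c] by (simp add: free_star_def)

lemma free_star_add [simp]: "free_star (a + b) = free_star a + free_star b"
  by (simp add: free_star_def map_key_plus[OF inj_rev_word])

lemma free_star_diff [simp]: "free_star (a - b) = free_star a - free_star b"
  by (metis add_diff_cancel diff_add_cancel free_star_add)

lemma free_star_star [simp]: "free_star (free_star a) = a"
  by (rule poly_mapping_eqI) (simp add: free_star_def map_key.rep_eq inj_rev_word)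

lemma rev_word_add: "rev_word (x + y) = rev_word y + rev_word x"
  by (simp add: rev_word_def plus_word_def)

lemma free_star_mult: "free_star (a * b) = free_star b * free_star a"
proof (induction a rule: Poly_Mapping.update_induct)
  case const
  then show ?case by (metis add_cancel_left_right diff_self free_star_add mult_zero_left mult_zero_right)
next
  case (update a w c)
  have eq: "Poly_Mapping.update w c a = a + Poly_Mapping.single w c"
    using update by (intro poly_mapping_eqI) (auto simp: lookup_update lookup_add lookup_single in_keys_iff)
  have single: "free_star (Poly_Mapping.single w c * b) = free_star b * Poly_Mapping.single (rev_word w) c"
  proof (induction b rule: Poly_Mapping.update_induct)
    case const
    then show ?case by (metis add_cancel_left_right diff_self free_star_add mult_zero_left mult_zero_right)
  next
    case (update b u d)
    have "Poly_Mapping.update u d b = b + Poly_Mapping.single u d"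
      using update by (intro poly_mapping_eqI) (auto simp: lookup_update lookup_add lookup_single in_keys_iff)
    then show ?case
      using update by (simp add: algebra_simps mult_single rev_word_add)
  qed
  show ?case
    using update single by (simp add: eq algebra_simps)
qed


section \<open>The Clifford algebra\<close>

text \<open>
  The free algebra is generated by the underlying set of \<open>V\<close>, so the first two families of
  relations are needed to make \<open>v \<mapsto> free_gen v\<close> linear; modulo these alone one obtains the
  tensor algebra of \<open>V\<close>.
\<close>

definition clifford_relations :: "('v::real_vector \<Rightarrow> real) \<Rightarrow> 'v free_alg set" where
  "clifford_relations f =
     {free_gen (v + w) - (free_gen v + free_gen w) | v w. True} \<union>
     {free_gen (c *\<^sub>R v) - free_const c * free_gen v | c v. True} \<union>
     {free_gen v * free_gen v - free_const (f v) | v. True}"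

definition clifford_ideal :: "('v::real_vector \<Rightarrow> real) \<Rightarrow> 'v free_alg set" where
  "clifford_ideal f = Idl\<^bsub>free_ring\<^esub> (clifford_relations f)"

definition clifford_class :: "('v::real_vector \<Rightarrow> real) \<Rightarrow> 'v free_alg \<Rightarrow> 'v free_alg set" where
  "clifford_class f a = clifford_ideal f +>\<^bsub>free_ring\<^esub> a"

definition clifford :: "('v::real_vector \<Rightarrow> real) \<Rightarrow> (real, 'v free_alg set) module" where
  "clifford f =
     (let Q = free_ring Quot clifford_ideal f in
      \<lparr>carrier = carrier Q, monoid.mult = (\<otimes>\<^bsub>Q\<^esub>), one = \<one>\<^bsub>Q\<^esub>, ring.zero = \<zero>\<^bsub>Q\<^esub>, add = (\<oplus>\<^bsub>Q\<^esub>),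
       smult = (\<lambda>c X. clifford_class f (free_const c) \<otimes>\<^bsub>Q\<^esub> X)\<rparr>)"

text \<open>
  The anti-automorphism reversing words leaves the ideal invariant (\<open>free_star_clifford_ideal\<close>
  below), so the image of a coset is again a coset.
\<close>

definition clifford_star :: "'v::real_vector free_alg set \<Rightarrow> 'v free_alg set" where
  "clifford_star X = free_star ` X"

definition is_clifford_trace ::
    "('v::real_vector \<Rightarrow> real) \<Rightarrow> ('v free_alg set \<Rightarrow> real) \<Rightarrow> bool" where
  "is_clifford_trace f t \<longleftrightarrow>
     (\<forall>x\<in>carrier (clifford f). \<forall>y\<in>carrier (clifford f). t (x \<oplus>\<^bsub>clifford f\<^esub> y) = t x + t y) \<and>
     (\<forall>c. \<forall>x\<in>carrier (clifford f). t (c \<odot>\<^bsub>clifford f\<^esub> x) = c * t x) \<and>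
     (\<forall>x\<in>carrier (clifford f). \<forall>y\<in>carrier (clifford f).
        t (x \<otimes>\<^bsub>clifford f\<^esub> y) = t (y \<otimes>\<^bsub>clifford f\<^esub> x)) \<and>
     t \<one>\<^bsub>clifford f\<^esub> = 1"

text \<open>\<^const>\<open>extensional\<close> fixes the irrelevant values off the carrier.\<close>

definition clifford_tr :: "('v::real_vector \<Rightarrow> real) \<Rightarrow> 'v free_alg set \<Rightarrow> real" where
  "clifford_tr f = (THE t. t \<in> extensional (carrier (clifford f)) \<and> is_clifford_trace f t)"

definition clifford_norm :: "('v::real_vector \<Rightarrow> real) \<Rightarrow> 'v free_alg set \<Rightarrow> real" where
  "clifford_norm f a = sqrt (clifford_tr f (a \<otimes>\<^bsub>clifford f\<^esub> clifford_star a))"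

definition clifford_automorphism ::
    "('v::real_vector \<Rightarrow> real) \<Rightarrow> ('v free_alg set \<Rightarrow> 'v free_alg set) \<Rightarrow> bool" where
  "clifford_automorphism f \<phi> \<longleftrightarrow>
     \<phi> \<in> ring_iso (clifford f) (clifford f) \<and>
     (\<forall>c. \<forall>x\<in>carrier (clifford f). \<phi> (c \<odot>\<^bsub>clifford f\<^esub> x) = c \<odot>\<^bsub>clifford f\<^esub> \<phi> x)"

definition clifford_continuous ::
    "('v::real_vector \<Rightarrow> real) \<Rightarrow> ('v free_alg set \<Rightarrow> 'v free_alg set) \<Rightarrow> bool" where
  "clifford_continuous f \<phi> \<longleftrightarrow>
     (\<forall>a\<in>carrier (clifford f). \<forall>\<epsilon>>0. \<exists>\<delta>>0. \<forall>b\<in>carrier (clifford f).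
        clifford_norm f (b \<ominus>\<^bsub>clifford f\<^esub> a) < \<delta> \<longrightarrow>
        clifford_norm f (\<phi> b \<ominus>\<^bsub>clifford f\<^esub> \<phi> a) < \<epsilon>)"

lemma ideal_clifford_ideal: "ideal (clifford_ideal f) free_ring"
  unfolding clifford_ideal_def
  by (rule ring.genideal_ideal[OF ring_free_ring]) (simp add: free_ring_def)

lemma clifford_relations_subset: "clifford_relations f \<subseteq> clifford_ideal f"
  unfolding clifford_ideal_def
  by (rule ring.genideal_self[OF ring_free_ring]) (simp add: free_ring_def)

lemma clifford_ideal_closed:
  shows clifford_ideal_zero: "0 \<in> clifford_ideal f"
    and clifford_ideal_add: "a \<in> clifford_ideal f \<Longrightarrow> b \<in> clifford_ideal f \<Longrightarrow> a + b \<in> clifford_ideal f"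
    and clifford_ideal_mult_left: "a \<in> clifford_ideal f \<Longrightarrow> x * a \<in> clifford_ideal f"
    and clifford_ideal_mult_right: "a \<in> clifford_ideal f \<Longrightarrow> a * x \<in> clifford_ideal f"
proof -
  interpret ideal "clifford_ideal f" free_ring
    by (rule ideal_clifford_ideal)
  show "0 \<in> clifford_ideal f"
    using additive_subgroup.zero_closed[OF is_additive_subgroup] by (simp add: free_ring_def)
  show "a + b \<in> clifford_ideal f" if "a \<in> clifford_ideal f" "b \<in> clifford_ideal f"
    using additive_subgroup.a_closed[OF is_additive_subgroup that] by (simp add: free_ring_def)
  show "x * a \<in> clifford_ideal f" if "a \<in> clifford_ideal f"
    using I_l_closed[OF that, of x] by (simp add: free_ring_def)
  show "a * x \<in> clifford_ideal f" if "a \<in> clifford_ideal f"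
    using I_r_closed[OF that, of x] by (simp add: free_ring_def)
qed

lemma clifford_ideal_uminus: "a \<in> clifford_ideal f \<Longrightarrow> - a \<in> clifford_ideal f"
  using clifford_ideal_mult_left[of a f "- 1"] by simp

lemma clifford_class_eq: "clifford_class f a = {i + a | i. i \<in> clifford_ideal f}"
  by (auto simp: clifford_class_def a_r_coset_def r_coset_def free_ring_def)

lemma clifford_class_eq_iff: "clifford_class f a = clifford_class f b \<longleftrightarrow> a - b \<in> clifford_ideal f"
proof
  assume "clifford_class f a = clifford_class f b"
  moreover have "a \<in> clifford_class f a"
    using clifford_ideal_zero[of f] by (force simp: clifford_class_eq)
  ultimately show "a - b \<in> clifford_ideal f"
    by (auto simp: clifford_class_eq)
next
  assume d: "a - b \<in> clifford_ideal f"
  show "clifford_class f a = clifford_class f b"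
  proof (intro equalityI subsetI)
    fix x assume "x \<in> clifford_class f a"
    then obtain i where "i \<in> clifford_ideal f" "x = i + a"
      by (auto simp: clifford_class_eq)
    then show "x \<in> clifford_class f b"
      using clifford_ideal_add[OF _ d, of i]
      by (auto simp: clifford_class_eq intro!: exI[of _ "i + (a - b)"])
  next
    fix x assume "x \<in> clifford_class f b"
    then obtain i where "i \<in> clifford_ideal f" "x = i + b"
      by (auto simp: clifford_class_eq)
    then show "x \<in> clifford_class f a"
      using clifford_ideal_add[OF _ clifford_ideal_uminus[OF d], of i]
      by (auto simp: clifford_class_eq intro!: exI[of _ "i + (b - a)"])
  qed
qed

lemma carrier_clifford: "carrier (clifford f) = range (clifford_class f)"
  by (auto simp: clifford_def Let_def FactRing_def A_RCOSETS_def' clifford_class_def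
      free_ring_def cong del: image_cong_simp)

lemma clifford_class_ops:
  "clifford_class f a \<oplus>\<^bsub>clifford f\<^esub> clifford_class f b = clifford_class f (a + b)"
  "clifford_class f a \<otimes>\<^bsub>clifford f\<^esub> clifford_class f b = clifford_class f (a * b)"
  "c \<odot>\<^bsub>clifford f\<^esub> clifford_class f a = clifford_class f (free_const c * a)"
  "\<one>\<^bsub>clifford f\<^esub> = clifford_class f 1"
  "\<zero>\<^bsub>clifford f\<^esub> = clifford_class f 0"
proof -
  interpret ideal "clifford_ideal f" free_ring
    by (rule ideal_clifford_ideal)
  have mult: "[mod clifford_ideal f:] clifford_class f x \<Otimes>\<^bsub>free_ring\<^esub> clifford_class f y
      = clifford_class f (x * y)" for x y
    using rcoset_mult_add[of x y] by (simp add: clifford_class_def) (simp add: free_ring_def)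
  show "clifford_class f a \<otimes>\<^bsub>clifford f\<^esub> clifford_class f b = clifford_class f (a * b)"
    "c \<odot>\<^bsub>clifford f\<^esub> clifford_class f a = clifford_class f (free_const c * a)"
    by (simp_all add: clifford_def Let_def FactRing_def mult)
  show "clifford_class f a \<oplus>\<^bsub>clifford f\<^esub> clifford_class f b = clifford_class f (a + b)"
    using a_rcos_sum[of a b]
    by (simp add: clifford_def Let_def FactRing_def clifford_class_def) (simp add: free_ring_def)
  show "\<one>\<^bsub>clifford f\<^esub> = clifford_class f 1"
    by (simp add: clifford_def Let_def FactRing_def clifford_class_def) (simp add: free_ring_def)
  show "\<zero>\<^bsub>clifford f\<^esub> = clifford_class f 0"
    by (simp add: clifford_def Let_def FactRing_def clifford_class_eq)
qed

lemma ring_clifford: "ring (clifford f)"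
proof (intro ringI abelian_groupI monoidI)
  fix x assume "x \<in> carrier (clifford f)"
  then obtain a where x: "x = clifford_class f a"
    by (auto simp: carrier_clifford)
  show "\<exists>y\<in>carrier (clifford f). y \<oplus>\<^bsub>clifford f\<^esub> x = \<zero>\<^bsub>clifford f\<^esub>"
    by (rule bexI[of _ "clifford_class f (- a)"]) (simp_all add: x carrier_clifford clifford_class_ops)
qed (auto simp: carrier_clifford clifford_class_ops algebra_simps)

lemma clifford_vector_square:
  "clifford_class f (free_gen v) \<otimes>\<^bsub>clifford f\<^esub> clifford_class f (free_gen v) =
     f v \<odot>\<^bsub>clifford f\<^esub> \<one>\<^bsub>clifford f\<^esub>"
proof -
  have "free_gen v * free_gen v - free_const (f v) \<in> clifford_ideal f"
    by (rule subsetD[OF clifford_relations_subset]) (auto simp: clifford_relations_def)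
  then show ?thesis
    by (simp add: clifford_class_ops clifford_class_eq_iff)
qed

lemma free_star_clifford_ideal: "free_star ` clifford_ideal f = clifford_ideal f"
proof -
  let ?J = "{a. free_star a \<in> clifford_ideal f}"
  have star_const: "free_star (free_const c) = free_const c" for c :: real
    by (simp add: free_const_def rev_word_def zero_word_def)
  have star_gen: "free_star (free_gen v) = free_gen v" for v :: 'a
    by (simp add: free_gen_def rev_word_def)
  have const_comm: "free_gen v * free_const c = free_const c * free_gen v" for v :: 'a and c
    by (simp add: free_gen_def free_const_def mult_single)
  have "ideal ?J free_ring"
  proof (rule idealI[OF ring_free_ring])
    show "subgroup ?J (add_monoid free_ring)"
    proof (rule group.subgroupI)
      show "group (add_monoid free_ring)"
        by (rule abelian_group.a_group[OF ring.is_abelian_group[OF ring_free_ring]])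
      show "?J \<noteq> {}"
        using clifford_ideal_zero[of f] by (metis (mono_tags) empty_iff free_star_star mem_Collect_eq)
      show "inv\<^bsub>add_monoid free_ring\<^esub> a \<in> ?J" if "a \<in> ?J" for a
      proof -
        have "inv\<^bsub>add_monoid free_ring\<^esub> a = - a"
          by (rule group.inv_equality[OF \<open>group (add_monoid free_ring)\<close>]) (simp_all add: free_ring_def)
        moreover have "free_star (- a) = - free_star a"
          using free_star_diff[of 0 a] free_star_diff[of 0 0] by simp
        ultimately show ?thesis
          using that by (simp add: clifford_ideal_uminus)
      qed
    qed (auto simp: free_ring_def clifford_ideal_add)
  qed (auto simp: free_ring_def free_star_mult clifford_ideal_mult_left clifford_ideal_mult_right)
  moreover have "free_star r = r" if "r \<in> clifford_relations f" for r
    using that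
    by (auto simp: clifford_relations_def free_star_mult star_const star_gen const_comm)
  then have "clifford_relations f \<subseteq> ?J"
    using clifford_relations_subset[of f] by auto
  ultimately have "clifford_ideal f \<subseteq> ?J"
    unfolding clifford_ideal_def by (rule ring.genideal_minimal[OF ring_free_ring])
  then have star: "free_star a \<in> clifford_ideal f" if "a \<in> clifford_ideal f" for a
    using that by blast
  then show ?thesis
    by (metis (no_types, lifting) free_star_star image_iff image_subsetI subsetI subset_antisym)
qed

lemma clifford_star_class: "clifford_star (clifford_class f a) = clifford_class f (free_star a)"
proof -
  have "clifford_star (clifford_class f a) = {j + free_star a | j. j \<in> free_star ` clifford_ideal f}"
    by (force simp: clifford_star_def clifford_class_eq)
  then show ?thesis
    by (simp add: free_star_clifford_ideal clifford_class_eq)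
qed

end

theory Submission
  imports Defs "HOL-Library.FSet" "HOL-Library.Function_Algebras"
begin

text \<open>
  Choose an orthonormal basis \<open>e\<^sub>0, e\<^sub>1, \<dots>\<close> of \<open>V\<close> and cut it into consecutive blocks of four. The product
  \<open>w\<^sub>n\<close> of the four vectors of block \<open>n\<close> satisfies \<open>w\<^sub>n\<^sup>2 = 1\<close> and \<open>w\<^sub>n\<^sup>* = w\<^sub>n\<close>, it anticommutes with the
  vectors of its own block, and it commutes with those of all other blocks. Put
  \<open>t\<^sub>n = sqrt (1 + n\<^sup>2) + n w\<^sub>n\<close>, a unit with inverse \<open>sqrt (1 + n\<^sup>2) - n w\<^sub>n\<close>. The elements \<open>e\<^sub>i t\<^sub>n\<close>, with \<open>n\<close> the
  block of \<open>i\<close>, again anticommute and have square \<open>1\<close>, so \<open>e\<^sub>i \<mapsto> e\<^sub>i t\<^sub>n\<close> extends to an endomorphism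
  (\<open>twisted_vector_square\<close>, \<open>twist_hom_cong\<close>). It fixes every \<open>w\<^sub>n\<close>, hence replacing \<open>n\<close> by \<open>- n\<close> in the
  coefficients gives the inverse endomorphism (\<open>twist_hom_inverse\<close>). It is discontinuous at \<open>0\<close> because
  \<open>e\<^sub>i\<close> has norm \<open>1\<close> while its image has squared norm \<open>tr (t\<^sub>n t\<^sub>n) = 1 + 2 n\<^sup>2\<close> (\<open>norm_twisted_gen\<close>).

  The norm is meaningful only if the trace exists and is unique. Existence comes from a Fock
  representation on real functions of finite index sets: the trace is a vacuum coefficient, and it is
  cyclic because left multiplications commute with right multiplications (\<open>fock_trace_commute\<close>).
  Uniqueness is an induction on the length of words (\<open>cyclic_functional_eq_0\<close>) that uses a basis
  vector orthogonal to the finitely many letters of a given word.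
\<close>

section \<open>The free algebra and its modules\<close>

lemma free_const_0 [simp]: "free_const 0 = 0"
  and free_const_1 [simp]: "free_const 1 = 1"
  by (simp_all add: free_const_def)

lemma free_const_add: "free_const (c + d) = free_const c + free_const d"
  by (simp add: free_const_def single_add)

lemma free_const_mult: "free_const (c * d) = free_const c * free_const d"
  by (simp add: free_const_def mult_single)

lemma free_const_diff: "free_const (c - d) = free_const c - free_const d"
  by (simp add: free_const_def single_diff)

lemma free_const_uminus: "free_const (- c) = - free_const c"
  by (simp add: free_const_def single_uminus)

definition free_word :: "'v list \<Rightarrow> 'v free_alg" where
  "free_word vs = prod_list (map free_gen vs)"

lemma free_word_simps [simp]:
  "free_word [] = 1"
  "free_word (v # vs) = free_gen v * free_word vs"
  "free_word (us @ vs) = free_word us * free_word vs"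
  by (simp_all add: free_word_def)

lemma free_word_single: "free_word vs = Poly_Mapping.single (Word vs) 1"
proof (induction vs)
  case Nil
  then show ?case by (simp flip: zero_word_def)
next
  case (Cons v vs)
  then show ?case by (simp add: free_gen_def mult_single plus_word_def)
qed

lemma single_eq_free_word: "Poly_Mapping.single w c = free_const c * free_word (letters w)"
  by (simp add: free_word_single free_const_def mult_single)

lemma free_alg_update:
  assumes "w \<notin> Poly_Mapping.keys a"
  shows "Poly_Mapping.update w c a = a + free_const c * free_word (letters w)"
  unfolding single_eq_free_word[symmetric] using assms
  by (intro poly_mapping_eqI) (auto simp: lookup_update lookup_add lookup_single in_keys_iff)

text \<open>
  Most identities below are proved either on words, by linearity, or on scalars and letters, by
  multiplicativity; the two induction rules make both reductions available.
\<close>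
lemma free_alg_linear_induct [case_names zero word add]:
  assumes "P 0" "\<And>c vs. P (free_const c * free_word vs)" "\<And>a b. P a \<Longrightarrow> P b \<Longrightarrow> P (a + b)"
  shows "P a"
  by (induction a rule: Poly_Mapping.update_induct) (auto simp: assms free_alg_update)

lemma free_alg_induct [case_names const gen add mult]:
  assumes const: "\<And>c. P (free_const c)" and gen: "\<And>v. P (free_gen v)"
    and add: "\<And>a b. P a \<Longrightarrow> P b \<Longrightarrow> P (a + b)" and mult: "\<And>a b. P a \<Longrightarrow> P b \<Longrightarrow> P (a * b)"
  shows "P a"
proof (induction a rule: free_alg_linear_induct)
  case zero
  show ?case using const[of 0] by simp
next
  case (word c vs)
  have "P (free_word vs)"
    using const[of 1] by (induction vs) (auto intro: gen mult)
  then show ?case by (intro mult const)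
next
  case (add a b)
  then show ?case by (rule assms(3))
qed

lemma free_const_commute: "a * free_const c = free_const c * a"
proof (induction a rule: free_alg_induct)
  case (gen v)
  then show ?case by (simp add: free_gen_def free_const_def mult_single)
next
  case (mult a b)
  have "a * b * free_const c = a * (free_const c * b)"
    by (simp add: mult.assoc mult)
  also have "\<dots> = free_const c * (a * b)"
    by (simp add: mult flip: mult.assoc)
  finally show ?case .
next
  case (const d)
  show ?case by (simp add: mult.commute flip: free_const_mult)
next
  case (add a b)
  then show ?case by (simp only: distrib_left distrib_right)
qed

lemma free_const_left_commute: "a * (free_const c * b) = free_const c * (a * b)"
  by (metis free_const_commute mult.assoc)

lemma free_star_const [simp]: "free_star (free_const c) = free_const c"
  by (simp add: free_const_def rev_word_def zero_word_def)

lemma free_star_gen [simp]: "free_star (free_gen v) = free_gen v"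
  by (simp add: free_gen_def rev_word_def)

lemma free_star_1 [simp]: "free_star 1 = 1"
  using free_star_const[of 1] by simp

lemma free_star_word: "free_star (free_word vs) = free_word (rev vs)"
  by (induction vs) (simp_all add: free_star_mult)

text \<open>
  A family of linear operators indexed by the letters is the same thing as a module over the free
  algebra. The module structure serves twice: with the operators of the Fock representation it
  produces the trace, and with left multiplications on a free algebra it produces algebra
  homomorphisms.
\<close>
locale free_action = vector_space scale
  for scale :: "real \<Rightarrow> 'm::ab_group_add \<Rightarrow> 'm" +
  fixes T :: "'v \<Rightarrow> 'm \<Rightarrow> 'm"
  assumes T_add: "T v (m + n) = T v m + T v n"
    and T_scale: "T v (scale c m) = scale c (T v m)"
begin

definition act :: "'v free_alg \<Rightarrow> 'm \<Rightarrow> 'm" where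
  "act a m = (\<Sum>w\<in>Poly_Mapping.keys a. scale (Poly_Mapping.lookup a w) (foldr T (letters w) m))"

lemma act_superset:
  assumes "finite K" "Poly_Mapping.keys a \<subseteq> K"
  shows "act a m = (\<Sum>w\<in>K. scale (Poly_Mapping.lookup a w) (foldr T (letters w) m))"
  unfolding act_def using assms
  by (intro sum.mono_neutral_left) (auto simp: in_keys_iff)

lemma act_0 [simp]: "act 0 m = 0"
  by (simp add: act_def)

lemma act_add: "act (a + b) m = act a m + act b m"
proof -
  let ?K = "Poly_Mapping.keys a \<union> Poly_Mapping.keys b"
  have "Poly_Mapping.keys (a + b) \<subseteq> ?K"
    by (rule Poly_Mapping.keys_add)
  then show ?thesis
    by (simp add: act_superset[of ?K] lookup_add scale_left_distrib sum.distrib)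
qed

lemma act_word: "act (free_const c * free_word vs) m = scale c (foldr T vs m)"
proof -
  have "free_const c * free_word vs = Poly_Mapping.single (Word vs) c"
    by (simp add: single_eq_free_word)
  then show ?thesis
    by (simp add: act_superset[of "{Word vs}"] lookup_single)
qed

lemma act_const [simp]: "act (free_const c) m = scale c m"
  using act_word[of c "[]"] by simp

lemma act_gen [simp]: "act (free_gen v) m = T v m"
  using act_word[of 1 "[v]"] by simp

text \<open>
  Taking for \<open>R\<close> a right multiplication, this turns the module structure into multiplicativity of
  \<open>free_lift\<close>; taking the right Fock operators, it gives cyclicity of the trace.
\<close>
lemma act_equivariant:
  assumes add: "\<And>m n. R (m + n) = R m + R n"
    and scale: "\<And>c m. R (scale c m) = scale c (R m)"
    and T: "\<And>v m. R (T v m) = T v (R m)"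
  shows "R (act a m) = act a (R m)"
proof -
  have zero: "R 0 = 0"
    using add[of 0 0] by simp
  have "R (foldr T vs m) = foldr T vs (R m)" for vs
    by (induction vs) (simp_all add: T)
  then show ?thesis
    by (induction a rule: free_alg_linear_induct) (simp_all add: zero act_word act_add add scale)
qed

lemma act_mult: "act (a * b) m = act a (act b m)"
proof (induction a rule: free_alg_linear_induct)
  case (word c vs)
  have foldr_add: "foldr T vs (m + n) = foldr T vs m + foldr T vs n" for m n
    by (induction vs) (simp_all add: T_add)
  have foldr_scale: "foldr T vs (scale d m) = scale d (foldr T vs m)" for d m
    by (induction vs) (simp_all add: T_scale)
  have foldr_0: "foldr T vs 0 = 0"
    using foldr_add[of 0 0] by simp
  show ?case
  proof (induction b rule: free_alg_linear_induct)
    case (word d us)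
    have "free_const c * free_word vs * (free_const d * free_word us)
        = free_const (c * d) * free_word (vs @ us)"
      using free_const_left_commute[of "free_word vs" d "free_word us"]
      by (simp add: free_const_mult mult.assoc)
    then show ?case
      by (simp add: act_word foldr_scale del: free_word_simps)
  next
    case (add a b)
    then show ?case
      by (simp only: distrib_left act_add) (simp only: act_word foldr_add scale_right_distrib)
  qed (simp add: act_word foldr_0)
next
  case (add a b)
  then show ?case by (simp only: act_add distrib_right)
qed simp

lemma act_add_right: "act a (m + n) = act a m + act a n"
proof (induction a arbitrary: m n rule: free_alg_induct)
  case (mult a b)
  then show ?case by (simp add: act_mult)
qed (simp_all add: act_add T_add scale_right_distrib)

lemma act_zero_right [simp]: "act a 0 = 0"
  using act_add_right[of a 0 0] by simp

lemma act_1 [simp]: "act 1 m = m"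
  using act_const[of 1] by simp

lemma act_diff: "act (a - b) m = act a m - act b m"
  by (metis act_add add_diff_cancel diff_add_cancel)

end

lemma vector_space_free_alg: "vector_space (\<lambda>c (x :: 'b free_alg). free_const c * x)"
  by unfold_locales (simp_all add: distrib_left distrib_right free_const_add free_const_mult mult.assoc)

lemma free_action_mult: "free_action (\<lambda>c x. free_const c * x) (\<lambda>v x. G v * x)"
  unfolding free_action_def free_action_axioms_def
  by (auto simp: vector_space_free_alg distrib_left free_const_left_commute)

definition free_lift :: "('v \<Rightarrow> 'w free_alg) \<Rightarrow> 'v free_alg \<Rightarrow> 'w free_alg" where
  "free_lift G a = free_action.act (\<lambda>c x. free_const c * x) (\<lambda>v x. G v * x) a 1"

context
  fixes G :: "'v \<Rightarrow> 'w free_alg"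
begin

interpretation free_action "\<lambda>c x. free_const c * x" "\<lambda>v x. G v * x"
  by (rule free_action_mult)

lemma free_lift_const [simp]: "free_lift G (free_const c) = free_const c"
  and free_lift_gen [simp]: "free_lift G (free_gen v) = G v"
  and free_lift_add [simp]: "free_lift G (a + b) = free_lift G a + free_lift G b"
  and free_lift_diff [simp]: "free_lift G (a - b) = free_lift G a - free_lift G b"
  by (simp_all add: free_lift_def act_add act_diff)

lemma free_lift_mult [simp]: "free_lift G (a * b) = free_lift G a * free_lift G b"
proof -
  have "act a 1 * act b 1 = act a (1 * act b 1)"
    by (rule act_equivariant) (simp_all add: distrib_right mult.assoc)
  then show ?thesis
    by (simp add: free_lift_def act_mult)
qed

lemma free_lift_0 [simp]: "free_lift G 0 = 0"
  using free_lift_const[of 0] by simp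

lemma free_lift_1 [simp]: "free_lift G 1 = 1"
  using free_lift_const[of 1] by simp

lemma free_lift_sum [simp]: "free_lift G (sum x I) = (\<Sum>i\<in>I. free_lift G (x i))"
  by (induction I rule: infinite_finite_induct) simp_all

end

section \<open>Congruence modulo the Clifford relations\<close>

text \<open>
  A map on the free algebra descends to the Clifford algebra once the elements to be sent to zero
  are seen to form a two-sided ideal that contains the defining relations.
\<close>
lemma clifford_ideal_minimal:
  assumes zero: "0 \<in> J" and add: "\<And>a b. a \<in> J \<Longrightarrow> b \<in> J \<Longrightarrow> a + b \<in> J"
    and left: "\<And>a x. a \<in> J \<Longrightarrow> x * a \<in> J" and right: "\<And>a x. a \<in> J \<Longrightarrow> a * x \<in> J"
    and rel: "clifford_relations f \<subseteq> J"
  shows "clifford_ideal f \<subseteq> J"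
proof -
  have grp: "group (add_monoid free_ring)"
    by (rule abelian_group.a_group[OF ring.is_abelian_group[OF ring_free_ring]])
  have "ideal J free_ring"
  proof (rule idealI[OF ring_free_ring])
    show "subgroup J (add_monoid free_ring)"
    proof (rule group.subgroupI[OF grp])
      show "inv\<^bsub>add_monoid free_ring\<^esub> a \<in> J" if "a \<in> J" for a
      proof -
        have "inv\<^bsub>add_monoid free_ring\<^esub> a = - a"
          by (rule group.inv_equality[OF grp]) (simp_all add: free_ring_def)
        then show ?thesis
          using left[OF that, of "- 1"] by simp
      qed
    qed (use zero add in \<open>auto simp: free_ring_def\<close>)
  qed (use left right in \<open>auto simp: free_ring_def\<close>)
  then show ?thesis
    unfolding clifford_ideal_def by (rule ring.genideal_minimal[OF ring_free_ring _ rel])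
qed

locale quadratic_space =
  fixes f :: "'v::real_vector \<Rightarrow> real"
  assumes quad: "quadratic_form f"
begin

text \<open>
  Computations in the Clifford algebra are carried out on representatives, where ring arithmetic is
  available from the type class; the relation \<open>\<approx>\<close> is equality in the quotient.
\<close>
definition cliff_eq :: "'v free_alg \<Rightarrow> 'v free_alg \<Rightarrow> bool" (infix \<open>\<approx>\<close> 50) where
  "a \<approx> b \<longleftrightarrow> clifford_class f a = clifford_class f b"

lemma cliff_eq_iff: "a \<approx> b \<longleftrightarrow> a - b \<in> clifford_ideal f"
  by (simp add: cliff_eq_def clifford_class_eq_iff)

lemma cliff_eq_refl [simp, intro!]: "a \<approx> a"
  by (simp add: cliff_eq_def)

lemma cliff_eq_sym [sym]: "a \<approx> b \<Longrightarrow> b \<approx> a"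
  by (simp add: cliff_eq_def)

lemma cliff_eq_trans [trans]: "a \<approx> b \<Longrightarrow> b \<approx> c \<Longrightarrow> a \<approx> c"
  by (simp add: cliff_eq_def)

lemma cliff_eq_trans_eq [trans]: "a = b \<Longrightarrow> b \<approx> c \<Longrightarrow> a \<approx> c" "a \<approx> b \<Longrightarrow> b = c \<Longrightarrow> a \<approx> c"
  by simp_all

lemma cliff_eq_add: "a \<approx> b \<Longrightarrow> c \<approx> d \<Longrightarrow> a + c \<approx> b + d"
  unfolding cliff_eq_def by (metis clifford_class_ops(1))

lemma cliff_eq_mult: "a \<approx> b \<Longrightarrow> c \<approx> d \<Longrightarrow> a * c \<approx> b * d"
  unfolding cliff_eq_def by (metis clifford_class_ops(2))

lemma cliff_eq_uminus: "a \<approx> b \<Longrightarrow> - a \<approx> - b"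
  using cliff_eq_mult[of "- 1" "- 1" a b] by simp

lemma cliff_eq_diff: "a \<approx> b \<Longrightarrow> c \<approx> d \<Longrightarrow> a - c \<approx> b - d"
  using cliff_eq_add[OF _ cliff_eq_uminus] by simp

lemma cliff_eq_sum: "(\<And>i. i \<in> I \<Longrightarrow> x i \<approx> y i) \<Longrightarrow> sum x I \<approx> sum y I"
  by (induction I rule: infinite_finite_induct) (simp_all add: cliff_eq_add)

lemma cliff_eq_mult_left: "b \<approx> c \<Longrightarrow> a * b \<approx> a * c"
  by (rule cliff_eq_mult) simp_all

lemma cliff_eq_mult_right: "a \<approx> b \<Longrightarrow> a * c \<approx> b * c"
  by (rule cliff_eq_mult) simp_all

lemma cliff_gen_add: "free_gen (v + w) \<approx> free_gen v + free_gen w"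
  unfolding cliff_eq_iff by (rule subsetD[OF clifford_relations_subset]) (auto simp: clifford_relations_def)

lemma cliff_gen_scale: "free_gen (c *\<^sub>R v) \<approx> free_const c * free_gen v"
  unfolding cliff_eq_iff by (rule subsetD[OF clifford_relations_subset]) (auto simp: clifford_relations_def)

lemma cliff_gen_square: "free_gen v * free_gen v \<approx> free_const (f v)"
  unfolding cliff_eq_iff by (rule subsetD[OF clifford_relations_subset]) (auto simp: clifford_relations_def)

lemma cliff_gen_0: "free_gen 0 \<approx> 0"
  using cliff_gen_scale[of 0 0] by simp

lemma cliff_gen_sum: "free_gen (sum x I) \<approx> (\<Sum>i\<in>I. free_gen (x i))"
proof (induction I rule: infinite_finite_induct)
  case (insert i I)
  have "free_gen (x i + sum x I) \<approx> free_gen (x i) + free_gen (sum x I)"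
    by (rule cliff_gen_add)
  also have "\<dots> \<approx> free_gen (x i) + (\<Sum>i\<in>I. free_gen (x i))"
    by (intro cliff_eq_add cliff_eq_refl insert.IH)
  finally show ?case using insert.hyps by simp
qed (simp_all add: cliff_gen_0)

text \<open>
  Polarization of the relation \<open>v\<^sup>2 = f v\<close>.
\<close>
lemma cliff_gen_anticommute:
  "free_gen v * free_gen w \<approx> free_const (polar f v w) - free_gen w * free_gen v"
proof -
  have "free_const (f (v + w)) \<approx> free_gen (v + w) * free_gen (v + w)"
    by (rule cliff_gen_square[THEN cliff_eq_sym])
  also have "\<dots> \<approx> (free_gen v + free_gen w) * (free_gen v + free_gen w)"
    by (intro cliff_eq_mult cliff_gen_add)
  also have "\<dots> = free_gen v * free_gen v + free_gen w * free_gen w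
      + (free_gen v * free_gen w + free_gen w * free_gen v)"
    by (simp add: algebra_simps)
  also have "\<dots> \<approx> free_const (f v) + free_const (f w)
      + (free_gen v * free_gen w + free_gen w * free_gen v)"
    by (intro cliff_eq_add cliff_eq_refl cliff_gen_square)
  finally have "free_const (f (v + w)) - free_const (f v + f w) - free_gen w * free_gen v \<approx>
      free_const (f v) + free_const (f w) + (free_gen v * free_gen w + free_gen w * free_gen v)
      - free_const (f v + f w) - free_gen w * free_gen v"
    by (intro cliff_eq_diff cliff_eq_refl)
  from this[THEN cliff_eq_sym] show ?thesis
    by (simp add: polar_def free_const_add free_const_diff algebra_simps)
qed

end

section \<open>Orthonormal coordinates\<close>

context quadratic_space
begin

lemma polar_bilinear: "bilinear (polar f)"
  using quad by (simp add: quadratic_form_def)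

lemma quad_scale: "f (c *\<^sub>R v) = c\<^sup>2 * f v"
  using quad by (simp add: quadratic_form_def)

lemma polar_commute: "polar f v w = polar f w v"
  by (simp add: polar_def add.commute)

lemma polar_self: "polar f v v = 2 * f v"
  using quad_scale[of 2 v] by (simp add: polar_def scaleR_2)

lemmas polar_simps =
  bilinear_ladd[OF polar_bilinear] bilinear_radd[OF polar_bilinear]
  bilinear_lmul[OF polar_bilinear] bilinear_rmul[OF polar_bilinear]
  bilinear_lzero[OF polar_bilinear] bilinear_rzero[OF polar_bilinear]
  bilinear_lsub[OF polar_bilinear] bilinear_rsub[OF polar_bilinear]

lemma polar_sum_left: "polar f (sum x I) w = (\<Sum>i\<in>I. polar f (x i) w)"
  by (induction I rule: infinite_finite_induct) (simp_all add: polar_simps)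

lemma polar_sum_right: "polar f v (sum x I) = (\<Sum>i\<in>I. polar f v (x i))"
  by (induction I rule: infinite_finite_induct) (simp_all add: polar_simps)

end

locale orthonormal_space = quadratic_space +
  fixes e :: "nat \<Rightarrow> 'a"
  assumes f_e [simp]: "f (e i) = 1"
    and polar_e: "i \<noteq> j \<Longrightarrow> polar f (e i) (e j) = 0"
    and span_e: "span (range e) = UNIV"
begin

definition coord :: "nat \<Rightarrow> 'a \<Rightarrow> real" where
  "coord i v = polar f v (e i) / 2"

definition supp :: "'a \<Rightarrow> nat set" where
  "supp v = {i. coord i v \<noteq> 0}"

lemma coord_e: "coord i (e j) = (if i = j then 1 else 0)"
  by (auto simp: coord_def polar_self polar_e)

lemma coord_add: "coord i (v + w) = coord i v + coord i w"
  and coord_scale: "coord i (c *\<^sub>R v) = c * coord i v"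
  and coord_0 [simp]: "coord i 0 = 0"
  by (simp_all add: coord_def polar_simps add_divide_distrib)

text \<open>
  Only finitely many coordinates of a vector are nonzero because the \<open>e i\<close> span \<open>V\<close> algebraically, not
  merely densely. All sums over the index set are therefore finite sums over supports.
\<close>
lemma coord_expansion: "finite (supp v) \<and> v = (\<Sum>i\<in>supp v. coord i v *\<^sub>R e i)"
proof -
  have "v \<in> span (range e)"
    by (simp add: span_e)
  then have "\<exists>K. finite K \<and> supp v \<subseteq> K \<and> v = (\<Sum>i\<in>K. coord i v *\<^sub>R e i)"
  proof (induction v rule: span_induct_alt)
    case base
    then show ?case by (auto simp: supp_def intro: exI[of _ "{}"])
  next
    case (step c x w)
    then obtain j K where x: "x = e j" and K: "finite K" "supp w \<subseteq> K" "w = (\<Sum>i\<in>K. coord i w *\<^sub>R e i)"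
      by auto
    have w: "w = (\<Sum>i\<in>insert j K. coord i w *\<^sub>R e i)"
      using K by (cases "j \<in> K") (auto simp: insert_absorb supp_def)
    have "(\<Sum>i\<in>insert j K. coord i (c *\<^sub>R e j) *\<^sub>R e i) = (\<Sum>i\<in>insert j K. if j = i then c *\<^sub>R e j else 0)"
      by (rule sum.cong) (auto simp: coord_scale coord_e)
    also have "\<dots> = c *\<^sub>R e j"
      using K(1) by (subst sum.delta') auto
    finally have "c *\<^sub>R x + w = (\<Sum>i\<in>insert j K. coord i (c *\<^sub>R x + w) *\<^sub>R e i)"
      using w by (simp add: x coord_add scaleR_add_left sum.distrib)
    moreover have "supp (c *\<^sub>R x + w) \<subseteq> insert j K"
      using K(2) by (auto simp: supp_def x coord_add coord_scale coord_e)
    ultimately show ?case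
      using K(1) by (intro exI[of _ "insert j K"]) auto
  qed
  then obtain K where K: "finite K" "supp v \<subseteq> K" "v = (\<Sum>i\<in>K. coord i v *\<^sub>R e i)"
    by blast
  have "(\<Sum>i\<in>supp v. coord i v *\<^sub>R e i) = (\<Sum>i\<in>K. coord i v *\<^sub>R e i)"
    using K by (intro sum.mono_neutral_left) (auto simp: supp_def)
  with K show ?thesis
    using finite_subset by auto
qed

lemma finite_supp [simp]: "finite (supp v)"
  using coord_expansion by blast

lemma f_eq_sum_squares: "f v = (\<Sum>i\<in>supp v. (coord i v)\<^sup>2)"
proof -
  have "2 * f v = polar f v (\<Sum>i\<in>supp v. coord i v *\<^sub>R e i)"
    using coord_expansion[of v] polar_self[of v] by simp
  also have "\<dots> = 2 * (\<Sum>i\<in>supp v. (coord i v)\<^sup>2)"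
    unfolding polar_sum_right sum_distrib_left
    by (rule sum.cong) (auto simp: polar_simps coord_def power2_eq_square)
  finally show ?thesis by simp
qed

text \<open>
  This is where infinite dimension enters: in odd finite dimension the product of an orthogonal basis
  is central, and the trace would not be unique.
\<close>
lemma ex_orthogonal_e: "finite X \<Longrightarrow> \<exists>i. \<forall>v\<in>X. polar f (e i) v = 0"
proof -
  assume "finite X"
  then have "finite (\<Union>v\<in>X. supp v)" by simp
  then obtain i where "i \<notin> (\<Union>v\<in>X. supp v)"
    using ex_new_if_finite infinite_UNIV_nat by blast
  then show ?thesis
    by (intro exI[of _ i]) (auto simp: supp_def coord_def polar_commute)
qed

definition lin_ext :: "(real \<Rightarrow> 'b \<Rightarrow> 'b) \<Rightarrow> (nat \<Rightarrow> 'b) \<Rightarrow> 'a \<Rightarrow> 'b::ab_group_add" where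
  "lin_ext s g v = (\<Sum>i\<in>supp v. s (coord i v) (g i))"

context
  fixes scale :: "real \<Rightarrow> 'b \<Rightarrow> 'b::ab_group_add"
  assumes vs: "vector_space scale"
begin

interpretation vector_space scale
  by (rule vs)

lemma lin_ext_superset:
  assumes "finite K" "supp v \<subseteq> K"
  shows "lin_ext scale g v = (\<Sum>i\<in>K. scale (coord i v) (g i))"
  unfolding lin_ext_def using assms by (intro sum.mono_neutral_left) (auto simp: supp_def)

lemma lin_ext_add: "lin_ext scale g (v + w) = lin_ext scale g v + lin_ext scale g w"
proof -
  let ?K = "supp v \<union> supp w"
  have "supp (v + w) \<subseteq> ?K" by (auto simp: supp_def coord_add)
  then show ?thesis
    by (simp add: lin_ext_superset[where K = ?K] coord_add scale_left_distrib sum.distrib)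
qed

lemma lin_ext_scale: "lin_ext scale g (c *\<^sub>R v) = scale c (lin_ext scale g v)"
proof -
  have "supp (c *\<^sub>R v) \<subseteq> supp v" by (auto simp: supp_def coord_scale)
  then show ?thesis
    by (simp add: lin_ext_superset[where K = "supp v"] coord_scale scale_sum_right)
qed

lemma lin_ext_e [simp]: "lin_ext scale g (e j) = g j"
  by (simp add: lin_ext_superset[where K = "{j}"] supp_def coord_e)

end

end

text \<open>
  The usual orthogonalization applies to a countable basis without any completeness because each
  step subtracts only finitely many projections. The factor \<open>1/2\<close> occurs because
  \<open>polar f v v = 2 * f v\<close>.
\<close>
fun gram_schmidt :: "('v::real_vector \<Rightarrow> real) \<Rightarrow> (nat \<Rightarrow> 'v) \<Rightarrow> nat \<Rightarrow> 'v" where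
  "gram_schmidt f b n =
     (let u = b n - (\<Sum>i<n. (polar f (b n) (gram_schmidt f b i) / 2) *\<^sub>R gram_schmidt f b i)
      in (1 / sqrt (f u)) *\<^sub>R u)"

declare gram_schmidt.simps [simp del]

lemma (in quadratic_space) ex_orthonormal_space:
  fixes B :: "'v set"
  assumes pos: "pos_definite f"
    and B: "independent B" "span B = UNIV" "countable B" "infinite B"
  shows "\<exists>e. orthonormal_space f e"
proof -
  define b where "b = from_nat_into B"
  have b: "range b = B" "inj b"
    using bij_betw_from_nat_into[OF B(3,4)] by (simp_all add: b_def bij_betw_def)
  define e where "e = gram_schmidt f b"
  define u where "u n = b n - (\<Sum>i<n. (polar f (b n) (e i) / 2) *\<^sub>R e i)" for n
  have e: "e n = (1 / sqrt (f (u n))) *\<^sub>R u n" for n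
    unfolding e_def u_def by (subst gram_schmidt.simps) (simp add: Let_def)
  have f_e: "f (e n) = 1" if "u n \<noteq> 0" for n
  proof -
    have "f (u n) > 0"
      using pos that by (simp add: pos_definite_def)
    then show ?thesis
      by (simp add: e quad_scale power_divide)
  qed
  have main: "u n \<noteq> 0 \<and> e n \<in> span (b ` {..n}) \<and> (\<forall>j<n. polar f (e n) (e j) = 0)" for n
  proof (induction n rule: less_induct)
    case (less n)
    have in_span: "e i \<in> span (b ` {..<n})" if "i < n" for i
    proof -
      have "b ` {..i} \<subseteq> b ` {..<n}" using that by auto
      then show ?thesis using less[OF that] span_mono by blast
    qed
    have sum_in: "(\<Sum>i<n. (polar f (b n) (e i) / 2) *\<^sub>R e i) \<in> span (b ` {..<n})"
      by (intro span_sum span_scale) (simp add: in_span)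
    have "b n \<notin> span (b ` {..<n})"
    proof
      assume "b n \<in> span (b ` {..<n})"
      moreover have "b ` {..<n} \<subseteq> B - {b n}"
        using b by (auto simp: inj_eq)
      ultimately have "b n \<in> span (B - {b n})"
        using span_mono by blast
      then show False
        using B(1) b(1) by (auto simp: dependent_def)
    qed
    then have nz: "u n \<noteq> 0"
      using sum_in by (auto simp: u_def)
    have "u n \<in> span (b ` {..n})"
      unfolding u_def
    proof (rule span_diff)
      show "b n \<in> span (b ` {..n})" by (rule span_base) simp
      have "b ` {..<n} \<subseteq> b ` {..n}" by auto
      then show "(\<Sum>i<n. (polar f (b n) (e i) / 2) *\<^sub>R e i) \<in> span (b ` {..n})"
        using sum_in span_mono by blast
    qed
    then have e_span: "e n \<in> span (b ` {..n})"
      unfolding e by (rule span_scale)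
    have "polar f (u n) (e j) = 0" if "j < n" for j
    proof -
      have orth: "polar f (e i) (e j) = (if i = j then 2 else 0)" if "i < n" for i
        using less[OF \<open>i < n\<close>] less[OF \<open>j < n\<close>] f_e[of j] polar_self[of "e j"] polar_commute[of "e i" "e j"]
        by (cases i j rule: linorder_cases) auto
      have "(\<Sum>i<n. polar f ((polar f (b n) (e i) / 2) *\<^sub>R e i) (e j))
          = (\<Sum>i<n. if i = j then polar f (b n) (e j) else 0)"
        by (rule sum.cong) (auto simp: polar_simps orth)
      then show ?thesis
        using that by (simp add: u_def polar_simps polar_sum_left)
    qed
    then show ?case
      using nz e_span by (simp add: e[of n] polar_simps)
  qed
  have fu: "f (u n) > 0" for n
    using main pos by (simp add: pos_definite_def)
  have "b n \<in> span (range e)" for n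
  proof -
    have "u n = sqrt (f (u n)) *\<^sub>R e n"
      using fu[of n] by (simp add: e)
    then have "u n \<in> span (range e)"
      by (metis rangeI span_base span_scale)
    moreover have "(\<Sum>i<n. (polar f (b n) (e i) / 2) *\<^sub>R e i) \<in> span (range e)"
      by (intro span_sum span_scale span_base) simp
    ultimately have "u n + (\<Sum>i<n. (polar f (b n) (e i) / 2) *\<^sub>R e i) \<in> span (range e)"
      by (rule span_add)
    then show ?thesis by (simp add: u_def)
  qed
  then have "B \<subseteq> span (range e)"
    using b(1) by auto
  then have "span (range e) = UNIV"
    using B(2) span_minimal[OF _ subspace_span] by blast
  moreover have "f (e n) = 1" for n
    using main by (intro f_e) blast
  moreover have "polar f (e i) (e j) = 0" if "i \<noteq> j" for i j
    using main[of i] main[of j] that polar_commute[of "e i" "e j"]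
    by (cases i j rule: linorder_cases) auto
  ultimately show ?thesis
    by (intro exI[of _ e]) unfold_locales
qed

text \<open>
  The square of a combination \<open>\<Sum>c\<^sub>i x\<^sub>i\<close> of anticommuting elements is \<open>\<Sum>c\<^sub>i\<^sup>2 x\<^sub>i\<^sup>2\<close>. The set \<open>I\<close> is \<open>{0}\<close> for the
  Fock operators and the Clifford ideal for the twisted generators.
\<close>
lemma sum_sum_anticommuting:
  fixes X :: "nat \<Rightarrow> nat \<Rightarrow> 'b::ab_group_add"
  assumes "finite S" and zero: "0 \<in> I" and add: "\<And>a b. a \<in> I \<Longrightarrow> b \<in> I \<Longrightarrow> a + b \<in> I"
    and anti: "\<And>i j. i \<in> S \<Longrightarrow> j \<in> S \<Longrightarrow> i \<noteq> j \<Longrightarrow> X i j + X j i \<in> I"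
  shows "(\<Sum>i\<in>S. \<Sum>j\<in>S. X i j) - (\<Sum>i\<in>S. X i i) \<in> I"
  using \<open>finite S\<close> anti
proof (induction S)
  case empty
  then show ?case by (simp add: zero)
next
  case (insert k S)
  note anti_S = insert.prems
  have sum_in: "(\<Sum>j\<in>T. X k j + X j k) \<in> I" if "T \<subseteq> S" for T
    using finite_subset[OF that insert.hyps(1)] that
  proof (induction T)
    case (insert j T)
    moreover have "X k j + X j k \<in> I"
      using insert.prems \<open>k \<notin> S\<close> by (intro anti_S) auto
    ultimately show ?case by (simp add: add)
  qed (simp add: zero)
  have "(\<Sum>i\<in>S. \<Sum>j\<in>S. X i j) - (\<Sum>i\<in>S. X i i) \<in> I"
    using insert by simp
  from add[OF sum_in[of S] this] insert.hyps show ?case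
    by (simp add: sum.distrib algebra_simps)
qed

section \<open>The Fock representation\<close>

text \<open>
  A finite set \<open>A\<close> of indices stands for the ordered product \<open>e\<^sub>A\<close> of the corresponding basis vectors.
  Multiplication of \<open>e\<^sub>A\<close> by \<open>e\<^sub>i\<close> flips the membership of \<open>i\<close>, up to the sign of moving \<open>e\<^sub>i\<close> to its place:
  past the smaller indices when multiplying from the left, past the larger ones from the right.
\<close>
definition flip :: "nat \<Rightarrow> nat fset \<Rightarrow> nat fset" where
  "flip i A = (if i |\<in>| A then A |-| {|i|} else finsert i A)"

definition sign_below :: "nat \<Rightarrow> nat fset \<Rightarrow> real" where
  "sign_below i A = (-1) ^ card {j. j |\<in>| A \<and> j < i}"

definition sign_above :: "nat \<Rightarrow> nat fset \<Rightarrow> real" where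
  "sign_above i A = (-1) ^ card {j. j |\<in>| A \<and> i < j}"

lemma mem_flip [simp]: "j |\<in>| flip i A \<longleftrightarrow> (if j = i then j |\<notin>| A else j |\<in>| A)"
  by (auto simp: flip_def)

lemma flip_flip [simp]: "flip i (flip i A) = A"
  by (rule fset_eqI) simp

lemma flip_commute: "flip i (flip j A) = flip j (flip i A)"
  by (rule fset_eqI) simp

lemma sign_flip:
  "(-1 :: real) ^ card {j. j |\<in>| flip i A \<and> P j} =
    (if P i then - ((-1) ^ card {j. j |\<in>| A \<and> P j}) else (-1) ^ card {j. j |\<in>| A \<and> P j})"
proof -
  have fin: "finite {j. j |\<in>| A \<and> P j}" for A
    by (rule finite_subset[of _ "fset A"]) auto
  show ?thesis
  proof (cases "P i")
    case False
    then have "{j. j |\<in>| flip i A \<and> P j} = {j. j |\<in>| A \<and> P j}" by auto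
    with False show ?thesis by simp
  next
    case True
    have out: "(-1 :: real) ^ card {j. j |\<in>| flip i B \<and> P j} = - ((-1) ^ card {j. j |\<in>| B \<and> P j})"
      if "i |\<notin>| B" for B
    proof -
      have "{j. j |\<in>| flip i B \<and> P j} = insert i {j. j |\<in>| B \<and> P j}"
        using that True by auto
      then show ?thesis using that fin by simp
    qed
    show ?thesis
      using out[of A] out[of "flip i A"] True by (cases "i |\<in>| A") auto
  qed
qed

lemma sign_below_flip: "sign_below i (flip j A) = (if j < i then - sign_below i A else sign_below i A)"
  unfolding sign_below_def by (rule sign_flip)

lemma sign_above_flip: "sign_above i (flip j A) = (if i < j then - sign_above i A else sign_above i A)"
  unfolding sign_above_def by (rule sign_flip)

lemma sign_square [simp]: "sign_below i A * sign_below i A = 1"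
  unfolding sign_below_def by (simp flip: power_mult_distrib)

context orthonormal_space
begin

text \<open>
  The operators \<open>fock v\<close> and \<open>right_fock v\<close> are left and right multiplication by \<open>v\<close> in the coordinates
  given by the \<open>e\<^sub>A\<close>. Linear independence of the \<open>e\<^sub>A\<close> in the Clifford algebra is not known
  beforehand; the operators are defined on all real functions of \<open>A\<close>, and the relations are
  verified directly.
\<close>
definition fock_scale :: "real \<Rightarrow> (nat fset \<Rightarrow> real) \<Rightarrow> nat fset \<Rightarrow> real" where
  "fock_scale c h = (\<lambda>A. c * h A)"

definition fock :: "'a \<Rightarrow> (nat fset \<Rightarrow> real) \<Rightarrow> nat fset \<Rightarrow> real" where
  "fock v h A = lin_ext (*) (\<lambda>i. sign_below i A * h (flip i A)) v"

definition right_fock :: "'a \<Rightarrow> (nat fset \<Rightarrow> real) \<Rightarrow> nat fset \<Rightarrow> real" where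
  "right_fock v h A = lin_ext (*) (\<lambda>i. sign_above i A * h (flip i A)) v"

definition vacuum :: "nat fset \<Rightarrow> real" where
  "vacuum A = (if A = {||} then 1 else 0)"

lemma vector_space_real: "vector_space ((*) :: real \<Rightarrow> real \<Rightarrow> real)"
  by unfold_locales (simp_all add: algebra_simps)

sublocale fock: free_action fock_scale fock
  by unfold_locales
    (auto simp: fock_scale_def fock_def lin_ext_def fun_eq_iff algebra_simps sum.distrib sum_distrib_left)

lemma fock_square: "fock v (fock v h) = fock_scale (f v) h"
proof
  fix A
  let ?X = "\<lambda>i j. coord i v * (sign_below i A * (coord j v * (sign_below j (flip i A) * h (flip j (flip i A)))))"
  have "(\<Sum>i\<in>supp v. \<Sum>j\<in>supp v. ?X i j) - (\<Sum>i\<in>supp v. ?X i i) \<in> {0}"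
  proof (rule sum_sum_anticommuting[where X = ?X])
    fix i j :: nat
    assume "i \<noteq> j"
    then show "?X i j + ?X j i \<in> {0}"
      by (simp add: sign_below_flip flip_commute[of i j])
  qed auto
  then have "(\<Sum>i\<in>supp v. \<Sum>j\<in>supp v. ?X i j) = (\<Sum>i\<in>supp v. ?X i i)"
    by simp
  also have "\<dots> = (\<Sum>i\<in>supp v. (coord i v)\<^sup>2 * h A)"
  proof (rule sum.cong[OF refl])
    fix i
    have "?X i i = (coord i v)\<^sup>2 * (sign_below i A * sign_below i A) * h A"
      unfolding sign_below_flip by (simp add: power2_eq_square)
    then show "?X i i = (coord i v)\<^sup>2 * h A"
      unfolding sign_square by simp
  qed
  finally show "fock v (fock v h) A = fock_scale (f v) h A"
    by (simp add: fock_def lin_ext_def fock_scale_def sum_distrib_left f_eq_sum_squares sum_distrib_right)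
qed

text \<open>
  Associativity \<open>(e\<^sub>j e\<^sub>A) e\<^sub>i = e\<^sub>j (e\<^sub>A e\<^sub>i)\<close>: both sides flip \<open>i\<close> and \<open>j\<close>, and the signs change together,
  namely exactly when \<open>i < j\<close>.
\<close>
lemma fock_right_fock: "right_fock v (fock w h) = fock w (right_fock v h)"
proof
  fix A
  have sign: "sign_above i A * sign_below j (flip i A) = sign_below j A * sign_above i (flip j A)" for i j
    by (cases i j rule: linorder_cases) (simp_all add: sign_below_flip sign_above_flip)
  have terms_eq: "coord i v * (sign_above i A * (coord j w * (sign_below j (flip i A) * h (flip j (flip i A)))))
      = coord j w * (sign_below j A * (coord i v * (sign_above i (flip j A) * h (flip i (flip j A)))))" for i j
    using arg_cong[OF sign[of i j], of "\<lambda>x. coord i v * coord j w * x * h (flip j (flip i A))"]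
    by (simp add: ac_simps flip_commute[of i j])
  show "right_fock v (fock w h) A = fock w (right_fock v h) A"
    unfolding fock_def right_fock_def lin_ext_def sum_distrib_left terms_eq by (rule sum.swap)
qed

lemma fock_vacuum: "fock v vacuum = right_fock v vacuum"
proof
  fix A
  have signs_eq: "sign_below i A * vacuum (flip i A) = sign_above i A * vacuum (flip i A)" for i
  proof (cases "flip i A = {||}")
    case True
    then have "A = flip i {||}" by (metis flip_flip)
    then show ?thesis by (simp add: sign_below_flip sign_above_flip) (simp add: sign_below_def sign_above_def)
  qed (simp add: vacuum_def)
  show "fock v vacuum A = right_fock v vacuum A"
    unfolding fock_def right_fock_def signs_eq ..
qed

lemma fock_at_empty: "fock v h {||} = right_fock v h {||}"
  by (simp add: fock_def right_fock_def sign_below_def sign_above_def)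

lemma fock_ideal: "a \<in> clifford_ideal f \<Longrightarrow> fock.act a h = 0"
proof -
  have "clifford_ideal f \<subseteq> {a. \<forall>h. fock.act a h = 0}"
  proof (rule clifford_ideal_minimal)
    have "fock (v + w) h = fock v h + fock w h" for v w h
      by (rule ext) (simp add: fock_def lin_ext_add[OF vector_space_real])
    moreover have "fock (c *\<^sub>R v) h = fock_scale c (fock v h)" for c v h
      by (rule ext) (simp add: fock_def fock_scale_def lin_ext_scale[OF vector_space_real])
    ultimately show "clifford_relations f \<subseteq> {a. \<forall>h. fock.act a h = 0}"
      by (auto simp: clifford_relations_def fock.act_diff fock.act_add fock.act_mult fock_square)
  qed (auto simp: fock.act_add fock.act_mult)
  then show "a \<in> clifford_ideal f \<Longrightarrow> fock.act a h = 0"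
    by blast
qed

text \<open>
  The vacuum stands for the unit, so applying \<open>a\<close> to it expands \<open>a\<close> in the \<open>e\<^sub>A\<close>; the trace is the coefficient of the unit.
\<close>
definition fock_trace :: "'a free_alg \<Rightarrow> real" where
  "fock_trace a = fock.act a vacuum {||}"

lemma fock_trace_add: "fock_trace (a + b) = fock_trace a + fock_trace b"
  and fock_trace_scale: "fock_trace (free_const c * a) = c * fock_trace a"
  and fock_trace_1: "fock_trace 1 = 1"
  by (simp_all add: fock_trace_def fock.act_add fock.act_mult fock_scale_def vacuum_def)

text \<open>
  It suffices to move one letter \<open>v\<close>. Left and right multiplication by \<open>v\<close> agree on the vacuum and
  in the coefficient at the empty set, and right multiplication commutes with the action of any \<open>b\<close>.
\<close>
lemma fock_trace_commute: "fock_trace (a * b) = fock_trace (b * a)"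
proof (induction a arbitrary: b rule: free_alg_induct)
  case (const c)
  then show ?case by (simp add: free_const_commute)
next
  case (gen v)
  have "right_fock v (fock.act b vacuum) = fock.act b (right_fock v vacuum)"
    by (rule fock.act_equivariant[OF _ _ fock_right_fock])
      (auto simp: fock_scale_def right_fock_def fun_eq_iff lin_ext_def algebra_simps sum.distrib
        sum_distrib_left)
  then show ?case
    by (simp add: fock_trace_def fock.act_mult fock_at_empty fock_vacuum)
next
  case (add a b c)
  then show ?case by (simp add: distrib_left distrib_right fock_trace_add)
next
  case (mult a1 a2 b)
  then show ?case by (metis mult.assoc)
qed

end

section \<open>Existence and uniqueness of the trace\<close>

context orthonormal_space
begin

text \<open>
  Uniqueness of the trace, applied below to a difference of two traces. Induction on the length of a
  word: modulo shorter words, on which \<open>d\<close> vanishes, moving a letter past another changes the sign.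
  In a word of even length, moving the first letter past the others and back by cyclicity gives
  \<open>d w = - d w\<close>. For a word of odd length, a unit vector \<open>e\<close> orthogonal to all its letters
  anticommutes with \<open>w\<close>, so \<open>d (e w e) = - d w\<close>, while cyclicity gives \<open>d (e w e) = d w\<close>.
\<close>
lemma cyclic_functional_eq_0:
  fixes d :: "'a free_alg \<Rightarrow> real"
  assumes cong: "\<And>a b. a \<approx> b \<Longrightarrow> d a = d b"
    and add: "\<And>a b. d (a + b) = d a + d b"
    and scale: "\<And>c a. d (free_const c * a) = c * d a"
    and commute: "\<And>a b. d (a * b) = d (b * a)"
    and one: "d 1 = 0"
  shows "d a = 0"
proof -
  have d0: "d 0 = 0"
    using scale[of 0 0] by simp
  have d_diff: "d (a - b) = d a - d b" for a b
    by (metis add add_diff_cancel diff_add_cancel)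
  \<comment> \<open>The hypothesis covers both uses: orthogonality makes the first factor zero, the
    induction hypothesis the second.\<close>
  have move: "d (free_word us * (free_gen v * free_word ws)) =
      (-1) ^ length ws * d (free_word us * (free_word ws * free_gen v))"
    if "\<And>x zs. x \<in> set ws \<Longrightarrow> length zs < length us + length ws \<Longrightarrow> polar f v x * d (free_word zs) = 0"
    for us v ws
    using that
  proof (induction ws arbitrary: us)
    case (Cons x ws)
    have "free_word us * (free_gen v * free_word (x # ws))
        = free_word us * (free_gen v * free_gen x) * free_word ws"
      by (simp add: mult.assoc)
    also have "\<dots> \<approx> free_word us * (free_const (polar f v x) - free_gen x * free_gen v) * free_word ws"
      by (intro cliff_eq_mult cliff_eq_refl cliff_gen_anticommute)
    also have "\<dots> = free_const (polar f v x) * free_word (us @ ws) -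
        free_word (us @ [x]) * (free_gen v * free_word ws)"
      unfolding right_diff_distrib left_diff_distrib free_const_commute
      by (simp add: mult.assoc)
    finally have "d (free_word us * (free_gen v * free_word (x # ws))) =
        polar f v x * d (free_word (us @ ws)) - d (free_word (us @ [x]) * (free_gen v * free_word ws))"
      by (simp add: cong d_diff scale del: free_word_simps)
    also have "polar f v x * d (free_word (us @ ws)) = 0"
      by (rule Cons.prems) auto
    also have "d (free_word (us @ [x]) * (free_gen v * free_word ws)) =
        (-1) ^ length ws * d (free_word (us @ [x]) * (free_word ws * free_gen v))"
      by (rule Cons.IH) (use Cons.prems in auto)
    finally show ?case
      by (simp add: mult.assoc)
  qed simp
  have word: "d (free_word vs) = 0" for vs
  proof (induction vs rule: length_induct)
    case (1 vs)
    show ?case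
    proof (cases "even (length vs)")
      case True
      show ?thesis
      proof (cases vs)
        case Nil
        then show ?thesis by (simp add: one)
      next
        case (Cons v ws)
        have "d (free_word [] * (free_gen v * free_word ws)) =
            (-1) ^ length ws * d (free_word [] * (free_word ws * free_gen v))"
          by (rule move) (use 1 Cons in auto)
        then have "d (free_gen v * free_word ws) = - d (free_word ws * free_gen v)"
          using True Cons by simp
        then show ?thesis
          using commute[of "free_gen v" "free_word ws"] Cons by simp
      qed
    next
      case False
      obtain i where i: "polar f (e i) x = 0" if "x \<in> set vs" for x
        using ex_orthogonal_e[of "set vs"] by auto
      have ee: "free_gen (e i) * free_gen (e i) \<approx> 1"
        using cliff_gen_square[of "e i"] by simp
      have "d (free_word vs) = d (free_gen (e i) * free_gen (e i) * free_word vs)"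
        using cong[OF cliff_eq_mult_right[OF ee, of "free_word vs"]] by simp
      also have "\<dots> = d (free_word [e i] * (free_gen (e i) * free_word vs))"
        by (simp add: mult.assoc)
      also have "\<dots> = (-1) ^ length vs * d (free_word [e i] * (free_word vs * free_gen (e i)))"
        by (rule move) (simp add: i)
      also have "d (free_word [e i] * (free_word vs * free_gen (e i))) = d (free_gen (e i) * free_gen (e i) * free_word vs)"
        using commute[of "free_word vs * free_gen (e i)" "free_gen (e i)"]
          commute[of "free_gen (e i) * free_gen (e i)" "free_word vs"]
        by (simp add: mult.assoc commute)
      also have "\<dots> = d (free_word vs)"
        using cong[OF cliff_eq_mult_right[OF ee, of "free_word vs"]] by simp
      finally show ?thesis
        using False by simp
    qed
  qed
  show ?thesis
    by (induction a rule: free_alg_linear_induct) (simp_all add: d0 scale word add)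
qed

lemma is_clifford_trace_iff:
  "is_clifford_trace f t \<longleftrightarrow>
     (\<forall>a b. t (clifford_class f (a + b)) = t (clifford_class f a) + t (clifford_class f b)) \<and>
     (\<forall>c a. t (clifford_class f (free_const c * a)) = c * t (clifford_class f a)) \<and>
     (\<forall>a b. t (clifford_class f (a * b)) = t (clifford_class f (b * a))) \<and>
     t (clifford_class f 1) = 1"
  by (simp add: is_clifford_trace_def carrier_clifford clifford_class_ops)

lemma ex1_clifford_trace: "\<exists>!t. t \<in> extensional (carrier (clifford f)) \<and> is_clifford_trace f t"
proof (rule ex_ex1I)
  define t where "t = restrict (\<lambda>X. fock_trace (SOME a. clifford_class f a = X)) (carrier (clifford f))"
  have t: "t (clifford_class f a) = fock_trace a" for a
  proof -
    have "(SOME b. clifford_class f b = clifford_class f a) - a \<in> clifford_ideal f"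
      unfolding clifford_class_eq_iff[symmetric] by (rule someI[of _ a]) simp
    then have "fock_trace (SOME b. clifford_class f b = clifford_class f a) = fock_trace a"
      using fock_ideal fock.act_diff unfolding fock_trace_def by (metis eq_iff_diff_eq_0)
    then show ?thesis
      by (simp add: t_def carrier_clifford)
  qed
  show "\<exists>t. t \<in> extensional (carrier (clifford f)) \<and> is_clifford_trace f t"
  proof (intro exI conjI)
    show "t \<in> extensional (carrier (clifford f))"
      by (simp add: t_def)
    show "is_clifford_trace f t"
      unfolding is_clifford_trace_iff t
      using fock_trace_add fock_trace_scale fock_trace_1 fock_trace_commute by blast
  qed
next
  fix t u
  assume t: "t \<in> extensional (carrier (clifford f)) \<and> is_clifford_trace f t"
    and u: "u \<in> extensional (carrier (clifford f)) \<and> is_clifford_trace f u"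
  have "t (clifford_class f a) - u (clifford_class f a) = 0" for a
  proof (rule cyclic_functional_eq_0)
    show "t (clifford_class f a) - u (clifford_class f a) = t (clifford_class f b) - u (clifford_class f b)"
      if "a \<approx> b" for a b
      using that by (simp add: cliff_eq_def)
  qed (use t u in \<open>auto simp: is_clifford_trace_iff right_diff_distrib\<close>)
  then have "t X = u X" if "X \<in> carrier (clifford f)" for X
    using that by (auto simp: carrier_clifford)
  then show "t = u"
    using t u by (auto intro: extensionalityI)
qed

text \<open>
  From here on only the characterizing properties of the trace are used, not its construction.
\<close>
definition tr :: "'a free_alg \<Rightarrow> real" where
  "tr a = clifford_tr f (clifford_class f a)"

lemma clifford_norm_class: "clifford_norm f (clifford_class f a) = sqrt (tr (a * free_star a))"
  by (simp add: clifford_norm_def tr_def clifford_star_class clifford_class_ops)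

lemma tr_cong: "a \<approx> b \<Longrightarrow> tr a = tr b"
  by (simp add: tr_def cliff_eq_def)

lemma tr_add: "tr (a + b) = tr a + tr b"
  and tr_scale: "tr (free_const c * a) = c * tr a"
  and tr_commute: "tr (a * b) = tr (b * a)"
  and tr_1: "tr 1 = 1"
proof -
  have "is_clifford_trace f (clifford_tr f)"
    using theI'[OF ex1_clifford_trace] by (simp add: clifford_tr_def)
  then show "tr (a + b) = tr a + tr b" "tr (free_const c * a) = c * tr a"
    "tr (a * b) = tr (b * a)" "tr 1 = 1"
    unfolding tr_def is_clifford_trace_iff by blast+
qed

end

section \<open>The twisting automorphisms\<close>

context orthonormal_space
begin

abbreviation gen :: "nat \<Rightarrow> 'a free_alg" where
  "gen i \<equiv> free_gen (e i)"

lemma gen_square: "gen i * gen i \<approx> 1"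
  using cliff_gen_square[of "e i"] by simp

lemma gen_anticommute: "i \<noteq> j \<Longrightarrow> gen i * gen j \<approx> - (gen j * gen i)"
  using cliff_gen_anticommute[of "e i" "e j"] by (simp add: polar_e)

lemma gen_word_commute:
  "gen i * free_word (map e js) \<approx> (-1) ^ length (filter (\<lambda>j. j \<noteq> i) js) * (free_word (map e js) * gen i)"
proof (induction js)
  case (Cons j js)
  let ?w = "free_word (map e js)" and ?k = "length (filter (\<lambda>j. j \<noteq> i) js)"
  have "gen i * free_word (map e (j # js)) = gen i * gen j * ?w"
    by (simp add: mult.assoc)
  also have "\<dots> \<approx> (if j = i then 1 else - 1) * (gen j * gen i) * ?w"
    using gen_anticommute[of i j] by (intro cliff_eq_mult_right) auto
  also have "\<dots> = (if j = i then 1 else - 1) * gen j * (gen i * ?w)"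
    by (simp add: mult.assoc)
  also have "\<dots> \<approx> (if j = i then 1 else - 1) * gen j * ((-1) ^ ?k * (?w * gen i))"
    by (intro cliff_eq_mult_left Cons.IH)
  also have "\<dots> = (-1) ^ length (filter (\<lambda>j. j \<noteq> i) (j # js)) * (free_word (map e (j # js)) * gen i)"
    by (cases "even ?k") (simp_all add: mult.assoc)
  finally show ?case .
qed simp

lemma gen_word_star: "free_word (map e js) * free_word (map e (rev js)) \<approx> 1"
proof (induction js)
  case (Cons j js)
  have "free_word (map e (j # js)) * free_word (map e (rev (j # js)))
      = gen j * (free_word (map e js) * free_word (map e (rev js))) * gen j"
    by (simp add: mult.assoc)
  also have "\<dots> \<approx> gen j * 1 * gen j"
    by (intro cliff_eq_mult_left cliff_eq_mult_right Cons.IH)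
  also have "\<dots> \<approx> 1"
    using gen_square[of j] by simp
  finally show ?case .
qed simp

text \<open>
  Four is the least positive length for which a product of distinct basis vectors is even and has square
  \<open>1\<close>. Evenness makes it commute with all basis vectors outside the block and anticommute with those
  inside.
\<close>
definition block :: "nat \<Rightarrow> 'a free_alg" where
  "block n = free_word (map e [4 * n, 4 * n + 1, 4 * n + 2, 4 * n + 3])"

lemma gen_block: "gen i * block n \<approx> (if i div 4 = n then - (block n * gen i) else block n * gen i)"
proof -
  define js where "js = [4 * n, 4 * n + 1, 4 * n + 2, 4 * n + 3]"
  have "i div 4 = n \<longleftrightarrow> i \<in> set js"
    by (auto simp: js_def)
  then have "length (filter (\<lambda>j. j \<noteq> i) js) = (if i div 4 = n then 3 else 4)"
    by (auto simp: js_def)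
  then show ?thesis
    using gen_word_commute[of i js] unfolding block_def js_def[symmetric]
    by (cases "i div 4 = n") simp_all
qed

text \<open>
  Reversing four anticommuting factors takes six transpositions, an even number.
\<close>
lemma block_star: "free_star (block n) \<approx> block n"
proof -
  define p q r s where "p = 4 * n" "q = 4 * n + 1" "r = 4 * n + 2" "s = 4 * n + 3"
  note pqrs = this
  have ne: "p \<noteq> q" "p \<noteq> r" "p \<noteq> s" "q \<noteq> r" "q \<noteq> s" "r \<noteq> s"
    by (simp_all add: pqrs)
  have "free_star (block n) = gen s * free_word (map e [r, q, p])"
    by (simp add: block_def free_star_mult pqrs mult.assoc)
  also have "\<dots> \<approx> - (gen r * free_word (map e [q, p]) * gen s)"
    using gen_word_commute[of s "[r, q, p]"] ne by (simp add: mult.assoc)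
  also have "\<dots> \<approx> - (gen q * gen p * gen r * gen s)"
    using gen_word_commute[of r "[q, p]"] ne
    by (intro cliff_eq_uminus cliff_eq_mult_right) (simp add: mult.assoc)
  also have "\<dots> \<approx> - (- (gen p * gen q) * gen r * gen s)"
    using gen_anticommute[of q p] ne by (intro cliff_eq_uminus cliff_eq_mult_right) simp
  also have "\<dots> = block n"
    by (simp add: block_def pqrs mult.assoc)
  finally show ?thesis .
qed

lemma block_square: "block n * block n \<approx> 1"
proof -
  have "block n * block n \<approx> block n * free_star (block n)"
    by (intro cliff_eq_mult_left cliff_eq_sym[OF block_star])
  also have "\<dots> \<approx> 1"
    unfolding block_def free_star_word using gen_word_star by (simp only: rev_map)
  finally show ?thesis .
qed

lemma block_commute: "block m * block n \<approx> block n * block m"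
proof (cases "m = n")
  case False
  have words: "free_word (map e js) * block n \<approx> block n * free_word (map e js)"
    if "\<And>j. j \<in> set js \<Longrightarrow> j div 4 \<noteq> n" for js
    using that
  proof (induction js)
    case (Cons j js)
    have "free_word (map e (j # js)) * block n \<approx> gen j * (block n * free_word (map e js))"
      using Cons by (simp add: mult.assoc cliff_eq_mult_left)
    also have "\<dots> = gen j * block n * free_word (map e js)"
      by (simp add: mult.assoc)
    also have "\<dots> \<approx> block n * gen j * free_word (map e js)"
      using gen_block[of j n] Cons.prems by (intro cliff_eq_mult_right) auto
    finally show ?case
      by (simp add: mult.assoc)
  qed simp
  show ?thesis
    unfolding block_def[of m] by (rule words) (use False in auto)
qed simp

lemma tr_block: "tr (block n) = 0"
proof -
  let ?g = "gen (4 * n)"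
  have g: "?g * ?g * block n \<approx> block n"
    using cliff_eq_mult_right[OF gen_square, of "4 * n" "block n"] by simp
  have "tr (block n) = tr (?g * ?g * block n)"
    by (rule tr_cong[OF g, symmetric])
  also have "\<dots> = tr (?g * block n * ?g)"
    using tr_commute[of ?g "?g * block n"] by (simp add: mult.assoc)
  also have "\<dots> = tr (- (block n * ?g) * ?g)"
    using gen_block[of "4 * n" n] by (intro tr_cong cliff_eq_mult_right) simp
  also have "\<dots> = - tr (?g * ?g * block n)"
    using tr_commute[of "block n" "?g * ?g"] tr_scale[of "- 1" "block n * (?g * ?g)"]
    by (simp add: mult.assoc free_const_uminus)
  also have "\<dots> = - tr (block n)"
    by (simp add: tr_cong[OF g])
  finally show ?thesis by simp
qed

text \<open>
  Modulo the relations, with \<open>x = sinh t\<close>, this is \<open>exp (t \<cdot> block n)\<close>: a unit with inverse \<open>exp (- t \<cdot> block n)\<close> whose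
  squared norm \<open>cosh (2 t)\<close> is unbounded in \<open>t\<close>.
\<close>
definition twist :: "real \<Rightarrow> nat \<Rightarrow> 'a free_alg" where
  "twist x n = free_const (sqrt (1 + x\<^sup>2)) + free_const x * block n"

lemma gen_twist:
  "gen i * twist x n \<approx> (if i div 4 = n then twist (- x) n * gen i else twist x n * gen i)"
proof -
  have "gen i * twist x n = free_const (sqrt (1 + x\<^sup>2)) * gen i + free_const x * (gen i * block n)"
    by (simp add: twist_def distrib_left free_const_commute free_const_left_commute)
  also have "\<dots> \<approx> free_const (sqrt (1 + x\<^sup>2)) * gen i +
      free_const x * (if i div 4 = n then - (block n * gen i) else block n * gen i)"
    by (intro cliff_eq_add cliff_eq_mult_left gen_block cliff_eq_refl)
  also have "\<dots> = (if i div 4 = n then twist (- x) n * gen i else twist x n * gen i)"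
    by (simp add: twist_def distrib_right left_diff_distrib mult.assoc free_const_uminus)
  finally show ?thesis .
qed

lemma block_polynomial_mult:
  "(free_const a + free_const x * u) * (free_const b + free_const y * v)
    = free_const (a * b) + free_const (a * y) * v + free_const (b * x) * u + free_const (x * y) * (u * v)"
proof -
  have "free_const x * u * free_const b = free_const (b * x) * u"
    by (metis free_const_commute free_const_mult mult.assoc)
  moreover have "free_const x * u * (free_const y * v) = free_const (x * y) * (u * v)"
    by (simp add: free_const_left_commute[of u] free_const_mult mult.assoc)
  ultimately show ?thesis
    by (simp add: distrib_left distrib_right free_const_mult mult.assoc)
qed

lemma twist_commute: "twist x m * twist y n \<approx> twist y n * twist x m"
proof -
  let ?a = "sqrt (1 + x\<^sup>2)" and ?b = "sqrt (1 + y\<^sup>2)"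
  have "twist x m * twist y n \<approx> free_const (?a * ?b) + free_const (?a * y) * block n
      + free_const (?b * x) * block m + free_const (x * y) * (block n * block m)"
    unfolding twist_def block_polynomial_mult
    by (intro cliff_eq_add cliff_eq_mult_left block_commute cliff_eq_refl)
  also have "\<dots> = twist y n * twist x m"
    unfolding twist_def block_polynomial_mult by (simp add: mult.commute[of ?a] mult.commute[of x])
  finally show ?thesis .
qed

lemma twist_mult:
  "twist x n * twist y n \<approx> free_const (sqrt (1 + x\<^sup>2) * sqrt (1 + y\<^sup>2) + x * y)
    + free_const (sqrt (1 + x\<^sup>2) * y + sqrt (1 + y\<^sup>2) * x) * block n"
proof -
  let ?a = "sqrt (1 + x\<^sup>2)" and ?b = "sqrt (1 + y\<^sup>2)"
  have "twist x n * twist y n \<approx> free_const (?a * ?b) + free_const (?a * y) * block n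
      + free_const (?b * x) * block n + free_const (x * y) * 1"
    unfolding twist_def block_polynomial_mult
    by (intro cliff_eq_add cliff_eq_mult_left block_square cliff_eq_refl)
  then show ?thesis
    by (simp add: free_const_add distrib_right add_ac)
qed

lemma twist_inverse: "twist x n * twist (- x) n \<approx> 1"
  using twist_mult[of x n "- x"] by (simp add: power2_eq_square[symmetric])

lemma twist_inverse': "twist (- x) n * twist x n \<approx> 1"
  using twist_inverse[of "- x" n] by simp

text \<open>
  On the block \<open>n\<close> this is conjugation by a unit: if \<open>s n = - sinh t\<close> and \<open>w = block n\<close>, then
  \<open>exp (t w / 2) e\<^sub>i exp (- t w / 2) = e\<^sub>i exp (- t w)\<close>, since \<open>e\<^sub>i\<close> anticommutes with \<open>w\<close>. Conjugating in all
  blocks at once makes sense although the infinite product of units does not exist in the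
  algebra, because each generator is affected by one factor only.
\<close>
definition twisted_gen :: "(nat \<Rightarrow> real) \<Rightarrow> nat \<Rightarrow> 'a free_alg" where
  "twisted_gen s i = gen i * twist (s (i div 4)) (i div 4)"

lemma twisted_gen_mult_same:
  assumes "i div 4 = j div 4"
  shows "twisted_gen s i * twisted_gen s j \<approx> gen i * gen j"
proof -
  define n x where "n = j div 4" "x = s n"
  note nx = this
  have "twist x n * gen j \<approx> gen j * twist (- x) n"
    using gen_twist[of j "- x" n, THEN cliff_eq_sym] by (simp add: nx)
  then have "gen i * (twist x n * gen j) * twist x n \<approx> gen i * (gen j * twist (- x) n) * twist x n"
    by (intro cliff_eq_mult_left cliff_eq_mult_right)
  also have "\<dots> = gen i * gen j * (twist (- x) n * twist x n)"
    by (simp add: mult.assoc)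
  also have "\<dots> \<approx> gen i * gen j * 1"
    by (intro cliff_eq_mult_left twist_inverse')
  finally show ?thesis
    using assms by (simp add: twisted_gen_def nx mult.assoc)
qed

lemma twisted_gen_mult_different:
  assumes "i div 4 \<noteq> j div 4"
  shows "twisted_gen s i * twisted_gen s j \<approx>
    gen i * gen j * (twist (s (i div 4)) (i div 4) * twist (s (j div 4)) (j div 4))"
proof -
  let ?t = "twist (s (i div 4)) (i div 4)" and ?u = "twist (s (j div 4)) (j div 4)"
  have "?t * gen j \<approx> gen j * ?t"
    using gen_twist[of j "s (i div 4)" "i div 4", THEN cliff_eq_sym] assms by simp
  then have "gen i * (?t * gen j) * ?u \<approx> gen i * (gen j * ?t) * ?u"
    by (intro cliff_eq_mult_left cliff_eq_mult_right)
  then show ?thesis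
    by (simp add: twisted_gen_def mult.assoc)
qed

lemma twisted_gen_square: "twisted_gen s i * twisted_gen s i \<approx> 1"
  using twisted_gen_mult_same[of i i s] gen_square cliff_eq_trans by blast

lemma twisted_gen_anticommute:
  assumes "i \<noteq> j"
  shows "twisted_gen s i * twisted_gen s j \<approx> - (twisted_gen s j * twisted_gen s i)"
proof (cases "i div 4 = j div 4")
  case True
  have "twisted_gen s i * twisted_gen s j \<approx> gen i * gen j"
    by (rule twisted_gen_mult_same[OF True])
  also have "\<dots> \<approx> - (gen j * gen i)"
    by (rule gen_anticommute[OF assms])
  also have "\<dots> \<approx> - (twisted_gen s j * twisted_gen s i)"
    by (rule cliff_eq_uminus[OF twisted_gen_mult_same[THEN cliff_eq_sym]]) (simp add: True)
  finally show ?thesis .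
next
  case False
  let ?t = "twist (s (i div 4)) (i div 4)" and ?u = "twist (s (j div 4)) (j div 4)"
  have "twisted_gen s i * twisted_gen s j \<approx> gen i * gen j * (?t * ?u)"
    by (rule twisted_gen_mult_different[OF False])
  also have "\<dots> \<approx> - (gen j * gen i) * (?u * ?t)"
    by (intro cliff_eq_mult gen_anticommute assms twist_commute)
  also have "\<dots> \<approx> - (twisted_gen s j * twisted_gen s i)"
    using cliff_eq_uminus[OF twisted_gen_mult_different[of j i s, THEN cliff_eq_sym]] False by simp
  finally show ?thesis .
qed

definition twisted_vector :: "(nat \<Rightarrow> real) \<Rightarrow> 'a \<Rightarrow> 'a free_alg" where
  "twisted_vector s = lin_ext (\<lambda>c x. free_const c * x) (twisted_gen s)"

lemmas twisted_vector_simps =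
  lin_ext_add[OF vector_space_free_alg, of "twisted_gen s" for s, folded twisted_vector_def]
  lin_ext_scale[OF vector_space_free_alg, of "twisted_gen s" for s, folded twisted_vector_def]
  lin_ext_e[OF vector_space_free_alg, of "twisted_gen s" for s, folded twisted_vector_def]

lemma twisted_vector_square: "twisted_vector s v * twisted_vector s v \<approx> free_const (f v)"
proof -
  let ?X = "\<lambda>i j. free_const (coord i v * coord j v) * (twisted_gen s i * twisted_gen s j)"
  have "free_const (coord i v) * twisted_gen s i * (free_const (coord j v) * twisted_gen s j) = ?X i j" for i j
    using free_const_left_commute[of "twisted_gen s i" "coord j v" "twisted_gen s j"]
    by (simp add: free_const_mult mult.assoc)
  then have "twisted_vector s v * twisted_vector s v = (\<Sum>i\<in>supp v. \<Sum>j\<in>supp v. ?X i j)"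
    by (simp add: twisted_vector_def lin_ext_def sum_product)
  also have "\<dots> \<approx> (\<Sum>i\<in>supp v. ?X i i)"
    unfolding cliff_eq_iff
  proof (rule sum_sum_anticommuting[where X = ?X])
    fix i j :: nat
    assume "i \<noteq> j"
    have "?X i j + ?X j i = free_const (coord i v * coord j v)
        * (twisted_gen s i * twisted_gen s j + twisted_gen s j * twisted_gen s i)"
      by (simp add: distrib_left mult.commute[of "coord i v"])
    also have "twisted_gen s i * twisted_gen s j + twisted_gen s j * twisted_gen s i \<in> clifford_ideal f"
      using twisted_gen_anticommute[OF \<open>i \<noteq> j\<close>] by (simp add: cliff_eq_iff)
    then have "free_const (coord i v * coord j v)
        * (twisted_gen s i * twisted_gen s j + twisted_gen s j * twisted_gen s i) \<in> clifford_ideal f"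
      by (rule clifford_ideal_mult_left)
    finally show "?X i j + ?X j i \<in> clifford_ideal f" .
  qed (simp_all add: clifford_ideal_zero clifford_ideal_add)
  also have "\<dots> \<approx> (\<Sum>i\<in>supp v. free_const (coord i v * coord i v) * 1)"
    by (intro cliff_eq_sum cliff_eq_mult_left twisted_gen_square)
  also have "\<dots> = free_const (f v)"
  proof -
    have "(\<Sum>i\<in>I. free_const (c i)) = free_const (\<Sum>i\<in>I. c i)" for I and c :: "nat \<Rightarrow> real"
      by (induction I rule: infinite_finite_induct) (simp_all add: free_const_add)
    then show ?thesis
      by (simp add: f_eq_sum_squares power2_eq_square)
  qed
  finally show ?thesis .
qed

abbreviation twist_hom :: "(nat \<Rightarrow> real) \<Rightarrow> 'a free_alg \<Rightarrow> 'a free_alg" where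
  "twist_hom s \<equiv> free_lift (twisted_vector s)"

lemma twist_hom_cong:
  assumes "a \<approx> b"
  shows "twist_hom s a \<approx> twist_hom s b"
proof -
  have "clifford_ideal f \<subseteq> {a. twist_hom s a \<in> clifford_ideal f}"
  proof (rule clifford_ideal_minimal)
    show "clifford_relations f \<subseteq> {a. twist_hom s a \<in> clifford_ideal f}"
      using twisted_vector_square
      by (auto simp: clifford_relations_def twisted_vector_simps clifford_ideal_zero cliff_eq_iff)
  qed (auto simp: clifford_ideal_zero clifford_ideal_add clifford_ideal_mult_left clifford_ideal_mult_right)
  then show ?thesis
    using assms by (auto simp: cliff_eq_iff)
qed

text \<open>
  Because pairs of twisted generators from one block multiply like the original ones, blocks are fixed,
  and opposite twists undo each other.
\<close>
lemma twist_hom_block: "twist_hom s (block n) \<approx> block n"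
proof -
  let ?g = "twisted_gen s"
  have "twist_hom s (block n) = ?g (4 * n) * ?g (4 * n + 1) * (?g (4 * n + 2) * ?g (4 * n + 3))"
    by (simp add: block_def twisted_vector_simps mult.assoc)
  also have "\<dots> \<approx> gen (4 * n) * gen (4 * n + 1) * (gen (4 * n + 2) * gen (4 * n + 3))"
    by (intro cliff_eq_mult twisted_gen_mult_same) simp_all
  also have "\<dots> = block n"
    by (simp add: block_def mult.assoc)
  finally show ?thesis .
qed

lemma twist_hom_twisted_gen: "twist_hom s (twisted_gen (- s) i) \<approx> gen i"
proof -
  define n where "n = i div 4"
  have "twist_hom s (twist (- s n) n) \<approx> twist (- s n) n"
    unfolding twist_def by (simp add: cliff_eq_add cliff_eq_mult_left twist_hom_block)
  then have "twist_hom s (twisted_gen (- s) i) \<approx> twisted_gen s i * twist (- s n) n"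
    by (simp add: twisted_gen_def[of "- s"] n_def[symmetric] twisted_vector_simps cliff_eq_mult_left)
  also have "\<dots> = gen i * (twist (s n) n * twist (- s n) n)"
    by (simp add: twisted_gen_def n_def mult.assoc)
  also have "\<dots> \<approx> gen i * 1"
    by (intro cliff_eq_mult_left twist_inverse)
  finally show ?thesis by (simp only: mult_1_right)
qed

lemma twist_hom_inverse: "twist_hom s (twist_hom (- s) a) \<approx> a"
proof (induction a rule: free_alg_induct)
  case (gen v)
  have "twist_hom s (twist_hom (- s) (free_gen v))
      = (\<Sum>i\<in>supp v. free_const (coord i v) * twist_hom s (twisted_gen (- s) i))"
    by (simp add: twisted_vector_def[of "- s"] lin_ext_def)
  also have "\<dots> \<approx> (\<Sum>i\<in>supp v. free_const (coord i v) * gen i)"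
    by (intro cliff_eq_sum cliff_eq_mult_left twist_hom_twisted_gen)
  also have "\<dots> \<approx> (\<Sum>i\<in>supp v. free_gen (coord i v *\<^sub>R e i))"
    by (intro cliff_eq_sum cliff_eq_sym[OF cliff_gen_scale])
  also have "\<dots> \<approx> free_gen (\<Sum>i\<in>supp v. coord i v *\<^sub>R e i)"
    by (rule cliff_eq_sym[OF cliff_gen_sum])
  also have "\<dots> = free_gen v"
    using coord_expansion[of v] by simp
  finally show ?case .
qed (simp_all add: cliff_eq_add cliff_eq_mult)

text \<open>
  The value does not depend on the chosen representative because twisting respects the ideal.
\<close>
definition twist_auto :: "(nat \<Rightarrow> real) \<Rightarrow> 'a free_alg set \<Rightarrow> 'a free_alg set" where
  "twist_auto s X = clifford_class f (twist_hom s (SOME a. clifford_class f a = X))"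

lemma twist_auto_class: "twist_auto s (clifford_class f a) = clifford_class f (twist_hom s a)"
proof -
  have "(SOME b. clifford_class f b = clifford_class f a) \<approx> a"
    unfolding cliff_eq_def by (rule someI[of _ a]) simp
  then show ?thesis
    using twist_hom_cong unfolding twist_auto_def cliff_eq_def by blast
qed

lemma twist_auto_automorphism: "clifford_automorphism f (twist_auto s)"
proof -
  have hom: "twist_auto s \<in> ring_hom (clifford f) (clifford f)"
    by (rule ring_hom_memI) (auto simp: carrier_clifford clifford_class_ops twist_auto_class)
  have right_inv: "twist_auto u (twist_auto (- u) X) = X" if "X \<in> carrier (clifford f)" for u X
    using that twist_hom_inverse[of u] by (auto simp: carrier_clifford twist_auto_class cliff_eq_def)
  have "bij_betw (twist_auto s) (carrier (clifford f)) (carrier (clifford f))"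
    using right_inv[of _ s] right_inv[of _ "- s"]
    by (intro bij_betw_byWitness[where f' = "twist_auto (- s)"])
      (auto simp: carrier_clifford twist_auto_class)
  then show ?thesis
    using hom by (auto simp: clifford_automorphism_def ring_iso_def carrier_clifford
        clifford_class_ops twist_auto_class)
qed

end

section \<open>Norms of twisted generators\<close>

context orthonormal_space
begin

lemma norm_scale:
  "clifford_norm f (clifford_class f (free_const c * a)) = \<bar>c\<bar> * sqrt (tr (a * free_star a))"
proof -
  have "free_star (free_const c * a) = free_const c * free_star a"
    by (simp add: free_star_mult free_const_commute[of "free_star a"])
  then have "free_const c * a * free_star (free_const c * a) = free_const c * (free_const c * (a * free_star a))"
    using free_const_left_commute[of a c "free_star a"] by (simp add: mult.assoc)
  then have "tr (free_const c * a * free_star (free_const c * a)) = c\<^sup>2 * tr (a * free_star a)"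
    by (simp only: tr_scale power2_eq_square mult.assoc[of c c])
  then show ?thesis
    by (simp only: clifford_norm_class real_sqrt_mult real_sqrt_abs)
qed

lemma norm_gen: "clifford_norm f (clifford_class f (free_const c * gen i)) = \<bar>c\<bar>"
  using tr_cong[OF gen_square[of i]] by (simp add: norm_scale tr_1)

text \<open>
  In \<open>tr (t\<^sup>* e\<^sub>i e\<^sub>i t) = tr (t t)\<close> the mixed term is a multiple of the trace of a block, which is \<open>0\<close>.
\<close>
lemma norm_twisted_gen:
  "clifford_norm f (clifford_class f (free_const c * twisted_gen s i)) = \<bar>c\<bar> * sqrt (1 + 2 * (s (i div 4))\<^sup>2)"
proof -
  define n x where "n = i div 4" "x = s n"
  note nx = this
  let ?t = "twist x n" and ?g = "twisted_gen s i"
  have star: "free_star ?t \<approx> ?t"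
    using cliff_eq_mult_left[OF block_star[of n], of "free_const x"]
    by (simp add: twist_def free_star_mult free_const_commute[of "free_star (block n)"] cliff_eq_add)
  have "tr (?g * free_star ?g) = tr (free_star ?g * ?g)"
    by (rule tr_commute)
  also have "\<dots> = tr (free_star ?t * (gen i * gen i) * ?t)"
    by (simp add: twisted_gen_def nx free_star_mult mult.assoc)
  also have "\<dots> = tr (?t * 1 * ?t)"
    by (intro tr_cong cliff_eq_mult star gen_square cliff_eq_refl)
  also have "\<dots> = tr (free_const (sqrt (1 + x\<^sup>2) * sqrt (1 + x\<^sup>2) + x * x) * 1
      + free_const (sqrt (1 + x\<^sup>2) * x + sqrt (1 + x\<^sup>2) * x) * block n)"
    using tr_cong[OF twist_mult[of x n x]] by (simp only: mult_1_right)
  also have "\<dots> = 1 + 2 * x\<^sup>2"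
    unfolding tr_add tr_scale tr_block tr_1 by (simp add: power2_eq_square[symmetric])
  finally have "tr (?g * free_star ?g) = 1 + 2 * x\<^sup>2" .
  then show ?thesis
    by (simp add: norm_scale nx)
qed

text \<open>
  The parameters \<open>s n = n\<close> are unbounded, hence so are the norms of the images of the unit vectors
  \<open>e\<^sub>4\<^sub>n\<close>; scaling them to norm \<open>\<delta> / 2\<close> defeats every \<open>\<delta>\<close>.
\<close>
lemma twist_auto_not_continuous: "\<not> clifford_continuous f (twist_auto real)"
proof
  assume cont: "clifford_continuous f (twist_auto real)"
  interpret cl: ring "clifford f"
    by (rule ring_clifford)
  let ?cls = "clifford_class f"
  have diff: "?cls b \<ominus>\<^bsub>clifford f\<^esub> ?cls 0 = ?cls b" for b
    using cl.r_zero[of "?cls b"]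
    by (simp add: a_minus_def carrier_clifford flip: clifford_class_ops(5))
  have "?cls 0 \<in> carrier (clifford f)"
    by (simp add: carrier_clifford)
  then obtain \<delta> where \<delta>: "\<delta> > 0" and small: "\<forall>b\<in>carrier (clifford f).
      clifford_norm f (b \<ominus>\<^bsub>clifford f\<^esub> ?cls 0) < \<delta> \<longrightarrow>
      clifford_norm f (twist_auto real b \<ominus>\<^bsub>clifford f\<^esub> twist_auto real (?cls 0)) < 1"
    using cont unfolding clifford_continuous_def by (meson zero_less_one)
  obtain n :: nat where n: "2 / \<delta> \<le> real n"
    using real_arch_simple by blast
  let ?b = "free_const (\<delta> / 2) * gen (4 * n)"
  have "clifford_norm f (?cls ?b) < \<delta>"
    using \<delta> by (simp add: norm_gen)
  then have "clifford_norm f (twist_auto real (?cls ?b) \<ominus>\<^bsub>clifford f\<^esub> twist_auto real (?cls 0)) < 1"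
    using small by (simp add: diff carrier_clifford)
  then have "\<delta> / 2 * sqrt (1 + 2 * (real n)\<^sup>2) < 1"
    using \<delta> by (simp add: twist_auto_class diff twisted_vector_simps norm_twisted_gen)
  moreover have "real n \<le> sqrt (1 + 2 * (real n)\<^sup>2)"
    by (rule real_le_rsqrt) simp
  then have "\<delta> / 2 * (2 / \<delta>) \<le> \<delta> / 2 * sqrt (1 + 2 * (real n)\<^sup>2)"
    using n \<delta> by (intro mult_left_mono) auto
  ultimately show False
    using \<delta> by simp
qed

end

theorem mainTheorem5:
  fixes f :: "'v::real_vector \<Rightarrow> real"
  assumes dim: "\<exists>B::'v set. independent B \<and> span B = UNIV \<and> countable B \<and> infinite B"
    and quad: "quadratic_form f"
    and pos: "pos_definite f"
  shows "\<exists>\<phi>. clifford_automorphism f \<phi> \<and> \<not> clifford_continuous f \<phi>"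
proof -
  interpret quadratic_space f
    by unfold_locales (rule quad)
  obtain e where "orthonormal_space f e"
    using dim ex_orthonormal_space[OF pos] by blast
  then interpret orthonormal_space f e .
  show ?thesis
    using twist_auto_automorphism twist_auto_not_continuous by blast
qed

end
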